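(* Let $n\ge p\ge1$ be integers, let $M\in\mathbb R^{p\times n}$, and let $\Sigma$ be a $p\times p$ full rank covariance matrix with symmetric square root $\Sigma^{1/2}$ and inverse square root $\Sigma^{-1/2}$. Let $\mathcal X\equiv\mathcal N_{p,n}(M,\Sigma,I_n)$ be a normal umbral matrix, and suppose $\Sigma^{-1/2}M=PD_mQ^{T}$ where $P$ and $Q$ are orthogonal matrices of order $p$ and $n$ respectively and $D_m$ is a $p\times n$ rectangular diagonal matrix containing $m_1,\dots,m_p$ in the elements with equal indices (and zeros elsewhere). Let $W=W_p(n,\Sigma,M)$ be the non-central Wishart random matrix. Let $\Delta_p=\mathrm{diag}(\delta_1,\dots,\delta_p)$ and $\tilde\Delta_n=\mathrm{diag}(\tilde\delta_1,\dots,\tilde\delta_n)$ be diagonal matrices of distinct delta umbrae, uncorrelated with each other and with the umbrae occurring in $\mathcal X$. Then $$p!\,\mathbb E[\mathrm{Tr}_p(W)]=\det(\Sigma)\,E\left\{\big(\mathrm{Tr}[(\Delta_pP^{T}\mathcal XQ\tilde\Delta_n)(\Delta_pP^{T}\mathcal XQ\tilde\Delta_n)^{T}]\big)^p\right\}.$$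
   Context: $\mathbb E$ is ordinary expectation. $\mathrm{Tr}_i(S)=e_i(Y_1,\dots,Y_p)$ is the $i$-th elementary symmetric function of the eigenvalues (latent roots) $Y_1,\dots,Y_p$ of a $p\times p$ matrix $S$; in particular $\mathrm{Tr}_p(S)=\det S$. $\mathrm{Tr}$ without subscript is the ordinary trace. The Wishart matrix $W_p(n,\Sigma,M)$ is $\mathsf X\mathsf X^{T}$ where $\mathsf X$ is a $p\times n$ random matrix ($n\ge p$) with independent columns, the $j$-th column being Gaussian with mean the $j$-th column of $M$ and covariance $\Sigma$. Umbral calculus: let $\mathcal A$ be a set of commuting formal symbols (umbrae) and $E$ a linear functional on $\mathbb R[\mathcal A]$ with $E[1]=1$ and $E(\alpha^i\gamma^j\cdots)=E(\alpha^i)E(\gamma^j)\cdots$ for distinct umbrae $\alpha,\gamma,\dots$ (distinct umbrae are uncorrelated). A delta umbra $\delta$ has generating function $E[e^{\delta z}]=1+z^2/2$, i.e. $E(\delta^k)=1$ for $k\in\{0,2\}$ and $E(\delta^k)=0$ otherwise. Normal umbral matrix: $\mathcal X\equiv\mathcal N_{p,n}(M,\Sigma,I_n)$ is a $p\times n$ matrix of elements of $\mathbb R[\mathcal A]$ with $E[\exp\mathrm{Tr}(\mathcal X^{T}Z)]=\exp\big[\mathrm{vec}(M)^{T}\mathrm{vec}(Z)+\tfrac12\mathrm{vec}(Z)^{T}(I_n\otimes\Sigma)\mathrm{vec}(Z)\big]$, where $\mathrm{vec}$ stacks columns and $\otimes$ is the Kronecker product; equivalently, the joint moments of its entries under $E$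 equal those of the entries of the random matrix $\mathsf X$ above.
   Formalization: The conclusion is proved with $\Sigma^{-1/2}\mathcal X$ in place of $\mathcal X$ inside the braces; as printed it fails for $p=n=1$, $\Sigma=s\ne1$, $M=m$, where the left side is $s+m^2$ and the right side $s(s+m^2)$. *)

theory Defs
  imports
    "HOL-Probability.Probability"
    "HOL-Library.Poly_Mapping"
    "HOL-Computational_Algebra.Computational_Algebra"
    "Jordan_Normal_Form.Char_Poly"
    "Jordan_Normal_Form.DL_Rank"
begin

no_notation inner (infix \<open>\<bullet>\<close> 70)

subsection \<open>Matrices\<close>

definition mat_trace :: "'a::comm_monoid_add mat \<Rightarrow> 'a" where
  "mat_trace A = (\<Sum>i<dim_row A. A $$ (i, i))"

(* Columns stacked: entry k lies in column k div dim_row A, row k mod dim_row A. *)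
definition vec_of_mat :: "'a mat \<Rightarrow> 'a Matrix.vec" where
  "vec_of_mat A = Matrix.vec (dim_row A * dim_col A)
     (\<lambda>k. A $$ (k mod dim_row A, k div dim_row A))"

definition kronecker :: "'a::times mat \<Rightarrow> 'a mat \<Rightarrow> 'a mat" where
  "kronecker A B = Matrix.mat (dim_row A * dim_row B) (dim_col A * dim_col B)
     (\<lambda>(k, l). A $$ (k div dim_row B, l div dim_col B) * B $$ (k mod dim_row B, l mod dim_col B))"

definition rect_diag :: "nat \<Rightarrow> nat \<Rightarrow> (nat \<Rightarrow> 'a::zero) \<Rightarrow> 'a mat" where
  "rect_diag p n m = Matrix.mat p n (\<lambda>(i, j). if i = j then m i else 0)"

(* JNF's orthogonal_mat only asks for pairwise orthogonal nonzero columns, without normalisation. *)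
definition orthogonal_matrix_of_order :: "nat \<Rightarrow> real mat \<Rightarrow> bool" where
  "orthogonal_matrix_of_order k Q \<longleftrightarrow>
     Q \<in> carrier_mat k k \<and> transpose_mat Q * Q = 1\<^sub>m k \<and> Q * transpose_mat Q = 1\<^sub>m k"

definition covariance_matrix :: "nat \<Rightarrow> real mat \<Rightarrow> bool" where
  "covariance_matrix p \<Sigma> \<longleftrightarrow> \<Sigma> \<in> carrier_mat p p \<and> transpose_mat \<Sigma> = \<Sigma> \<and>
     (\<forall>v\<in>carrier_vec p. 0 \<le> v \<bullet> (\<Sigma> *\<^sub>v v))"


subsection \<open>Elementary symmetric functions of the latent roots\<close>

definition elem_sym :: "nat \<Rightarrow> 'a::comm_ring_1 list \<Rightarrow> 'a" where
  "elem_sym i ys = (\<Sum>I | I \<subseteq> {..<length ys} \<and> card I = i. \<Prod>k\<in>I. ys ! k)"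

(* All complex eigenvalues, listed with algebraic multiplicity in an unspecified order
   (elem_sym does not depend on the order). *)
definition latent_roots :: "real mat \<Rightarrow> complex list" where
  "latent_roots S = (SOME ys. mset ys = proots (char_poly (map_mat complex_of_real S)))"

(* The eigenvalues of a real matrix are closed under conjugation, so elem_sym is a real number
   here, and Re only changes the type. *)
definition Tr :: "nat \<Rightarrow> real mat \<Rightarrow> real" where
  "Tr i S = Re (elem_sym i (latent_roots S))"


subsection \<open>Gaussian and Wishart random matrices\<close>

(* A random vector is Gaussian with mean \<mu> and covariance \<Sigma> if each of its linear functionals
   v \<bullet> x is univariate normal with mean v \<bullet> \<mu> and variance v \<bullet> \<Sigma> v.  The densities require that
   variance to be positive for v \<noteq> 0, that is, \<Sigma> to have full rank. *)
definition gaussian_vector ::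
    "'w measure \<Rightarrow> nat \<Rightarrow> real Matrix.vec \<Rightarrow> real mat \<Rightarrow> ('w \<Rightarrow> real Matrix.vec) \<Rightarrow> bool" where
  "gaussian_vector \<Omega> p \<mu> \<Sigma> x \<longleftrightarrow> (\<forall>\<omega>\<in>space \<Omega>. x \<omega> \<in> carrier_vec p) \<and>
     (\<forall>v\<in>carrier_vec p. v \<noteq> 0\<^sub>v p \<longrightarrow>
        distributed \<Omega> lborel (\<lambda>\<omega>. v \<bullet> x \<omega>) (normal_density (v \<bullet> \<mu>) (sqrt (v \<bullet> (\<Sigma> *\<^sub>v v)))))"

definition gaussian_matrix ::
    "'w measure \<Rightarrow> nat \<Rightarrow> nat \<Rightarrow> real mat \<Rightarrow> real mat \<Rightarrow> ('w \<Rightarrow> real mat) \<Rightarrow> bool" where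
  "gaussian_matrix \<Omega> p n M \<Sigma> X \<longleftrightarrow> prob_space \<Omega> \<and>
     (\<forall>\<omega>\<in>space \<Omega>. X \<omega> \<in> carrier_mat p n) \<and>
     (\<forall>j<n. gaussian_vector \<Omega> p (col M j) \<Sigma> (\<lambda>\<omega>. col (X \<omega>) j)) \<and>
     prob_space.indep_vars \<Omega> (\<lambda>j. Pi\<^sub>M {..<p} (\<lambda>i. borel))
       (\<lambda>j \<omega>. \<lambda>i\<in>{..<p}. X \<omega> $$ (i, j)) {..<n}"

definition wishart_matrix ::
    "'w measure \<Rightarrow> nat \<Rightarrow> nat \<Rightarrow> real mat \<Rightarrow> real mat \<Rightarrow> ('w \<Rightarrow> real mat) \<Rightarrow> bool" where
  "wishart_matrix \<Omega> p n \<Sigma> M W \<longleftrightarrow> p \<le> n \<and>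
     (\<exists>X. gaussian_matrix \<Omega> p n M \<Sigma> X \<and> (\<forall>\<omega>\<in>space \<Omega>. W \<omega> = X \<omega> * transpose_mat (X \<omega>)))"


subsection \<open>Umbral calculus\<close>

(* Real polynomials in the umbrae, which are the elements of the type 'u. *)
type_synonym 'u umbral_poly = "('u \<Rightarrow>\<^sub>0 nat) \<Rightarrow>\<^sub>0 real"

definition uconst :: "real \<Rightarrow> 'u umbral_poly" where
  "uconst c = Poly_Mapping.single 0 c"

definition umbra :: "'u \<Rightarrow> 'u umbral_poly" where
  "umbra \<alpha> = Poly_Mapping.single (Poly_Mapping.single \<alpha> 1) 1"

definition umbrae_of :: "'u umbral_poly \<Rightarrow> 'u set" where
  "umbrae_of q = (\<Union>\<mu>\<in>Poly_Mapping.keys q. Poly_Mapping.keys \<mu>)"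

definition umbral_evaluation :: "('u umbral_poly \<Rightarrow> real) \<Rightarrow> bool" where
  "umbral_evaluation E \<longleftrightarrow>
     (\<forall>q r. E (q + r) = E q + E r) \<and>
     (\<forall>c q. E (uconst c * q) = c * E q) \<and>
     E 1 = 1 \<and>
     (\<forall>A k. finite A \<longrightarrow> E (\<Prod>\<alpha>\<in>A. umbra \<alpha> ^ k \<alpha>) = (\<Prod>\<alpha>\<in>A. E (umbra \<alpha> ^ k \<alpha>)))"

(* E[exp (q z)] as a formal power series in z. *)
definition umbral_gf :: "('u umbral_poly \<Rightarrow> real) \<Rightarrow> 'u umbral_poly \<Rightarrow> real fps" where
  "umbral_gf E q = Abs_fps (\<lambda>k. E (q ^ k) / fact k)"

definition delta_umbra :: "('u umbral_poly \<Rightarrow> real) \<Rightarrow> 'u \<Rightarrow> bool" where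
  "delta_umbra E \<delta> \<longleftrightarrow> umbral_gf E (umbra \<delta>) = 1 + fps_const (1/2) * fps_X ^ 2"

(* N_{p,n}(M, \<Sigma>, I_n).  The identity
     E[exp Tr(X^T Z)] = exp (vec(M)^T vec(Z) + vec(Z)^T (I_n (x) \<Sigma>) vec(Z) / 2)
   between formal power series in the entries of Z is stated as the family of identities between
   formal power series in t obtained by putting t Z for Z, for all real Z.  The coefficient of t^k
   is the homogeneous part of degree k in the entries of Z, a polynomial, and is determined by its
   values at real Z. *)
definition normal_umbral_matrix ::
    "('u umbral_poly \<Rightarrow> real) \<Rightarrow> nat \<Rightarrow> nat \<Rightarrow> real mat \<Rightarrow> real mat \<Rightarrow> 'u umbral_poly mat \<Rightarrow> bool" where
  "normal_umbral_matrix E p n M \<Sigma> X \<longleftrightarrow> X \<in> carrier_mat p n \<and>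
     (\<forall>Z\<in>carrier_mat p n.
        umbral_gf E (mat_trace (transpose_mat X * map_mat uconst Z)) =
        fps_exp 1 oo
          (fps_const (vec_of_mat M \<bullet> vec_of_mat Z) * fps_X +
           fps_const (1/2 * (vec_of_mat Z \<bullet> (kronecker (1\<^sub>m n) \<Sigma> *\<^sub>v vec_of_mat Z))) * fps_X ^ 2))"

(* Pitfall of normalisation: for W = X X^T with X of covariance \<Sigma>, det(W) / det(\<Sigma>) is the
   determinant belonging to the whitened matrix \<Sigma>^(-1/2) X, which has mean \<Sigma>^(-1/2) M and
   covariance I_p.  An identity p! E[det(W)] = det(\<Sigma>) E{(Tr[Y Y^T])^p} therefore needs
   Y = \<Delta> P^T (\<Sigma>^(-1/2) X) Q \<Delta>'.  With X in place of \<Sigma>^(-1/2) X it fails already for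
   p = n = 1, where the left side is \<Sigma> + M^2 and the right side \<Sigma> (\<Sigma> + M^2). *)

end

theory Submission
  imports Defs
begin

text \<open>
  Put \<open>G = P\<^sup>T \<Sigma>\<^sup>-\<^sup>1\<^sup>/\<^sup>2 X Q\<close>: its entries are Gaussian with identity covariance, and off the diagonal they
  are centred.  Expanding \<open>det (G G\<^sup>T)\<close> over injections \<open>f : {1..p} \<rightarrow> {1..n}\<close> and permutations \<open>\<sigma>\<close>, the
  term \<open>sgn \<sigma> \<Prod>\<^sub>i G (i, f i) G (\<sigma> i, f i)\<close> has mean zero unless \<open>\<sigma> = id\<close>, since it is linear in some
  centred entry.  So the mean of \<open>det (X X\<^sup>T) = det \<Sigma> det (G G\<^sup>T)\<close> is
  \<open>det \<Sigma>\<close> times the sum over \<open>f\<close> of the means of \<open>\<Prod>\<^sub>i G (i, f i)\<^sup>2\<close>.  On the umbral side,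
  \<open>E \<delta>\<^sup>2 = 1\<close> and \<open>E \<delta>\<^sup>k = 0\<close> for all \<open>k > 2\<close> keep from the \<open>p\<close>-th power of
  \<open>\<Sum> \<delta>\<^sub>i\<^sup>2 \<delta>'\<^sub>j\<^sup>2 G (i, j)\<^sup>2\<close> precisely these products, each \<open>p!\<close> times.

  Umbral and probabilistic moments are compared by polarization: a product of linear forms is a
  combination of powers of linear forms, and the moments of a single linear form depend only on its
  mean and variance.
\<close>

subsection \<open>Polarization\<close>

text \<open>Permutations fix every point outside \<open>A\<close>, whereas functions in
  \<open>A \<rightarrow>\<^sub>E A\<close> are \<open>undefined\<close> there. Restriction and
  extension by the identity translate between the two conventions, so that such bijections can be
  counted by \<open>fact (card A)\<close>.\<close>

lemma bij_betw_restrict_permutes: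
  "bij_betw (\<lambda>\<pi>. restrict \<pi> A) {\<pi>. \<pi> permutes A} {g \<in> A \<rightarrow>\<^sub>E A. bij_betw g A A}"
proof (rule bij_betw_byWitness[where f' = "\<lambda>g x. if x \<in> A then g x else x"])
  show "(\<lambda>g x. if x \<in> A then g x else x) ` {g \<in> A \<rightarrow>\<^sub>E A. bij_betw g A A} \<subseteq> {\<pi>. \<pi> permutes A}"
    by (auto intro!: bij_imp_permutes cong: bij_betw_cong)
  show "(\<lambda>\<pi>. restrict \<pi> A) ` {\<pi>. \<pi> permutes A} \<subseteq> {g \<in> A \<rightarrow>\<^sub>E A. bij_betw g A A}"
    using permutes_imp_bij permutes_in_image[of _ A] by (fastforce simp: bij_betw_restrict_eq)
qed (auto simp: permutes_def fun_eq_iff PiE_def extensional_def)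

text \<open>Inclusion-exclusion: expand the product over x in \<open>A\<close> of 1 + e(x), where
  e(x) is 0 on \<open>R\<close> and -1 off \<open>R\<close>. A point of \<open>A\<close> outside
  \<open>R\<close> makes the product vanish.\<close>

lemma alternating_sum_supersets:
  assumes "finite A" "R \<subseteq> A"
  shows "(\<Sum>S\<in>Pow A. if R \<subseteq> S then (-1) ^ card (A - S) else 0) = (if R = A then 1 else 0 :: 'a::comm_ring_1)"
proof -
  have "(if R = A then 1 else 0 :: 'a) = (\<Prod>x\<in>A. 1 + (if x \<in> R then 0 else -1))"
    using assms by (auto intro!: prod_zero)
  also have "\<dots> = (\<Sum>S\<in>Pow A. \<Prod>x\<in>A-S. if x \<in> R then 0 else -1)"
    using assms by (subst prod_add) auto
  also have "\<dots> = (\<Sum>S\<in>Pow A. if R \<subseteq> S then (-1) ^ card (A - S) else 0)"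
  proof (rule sum.cong)
    fix S assume S: "S \<in> Pow A"
    show "(\<Prod>x\<in>A-S. if x \<in> R then 0 else -1) = (if R \<subseteq> S then (-1) ^ card (A - S) else 0 :: 'a)"
    proof (cases "R \<subseteq> S")
      case True
      then have "(\<Prod>x\<in>A-S. if x \<in> R then 0 else -1) = (\<Prod>x\<in>A-S. - 1 :: 'a)"
        by (intro prod.cong) auto
      with True show ?thesis by simp
    next
      case False
      with assms show ?thesis by (auto intro!: prod_zero)
    qed
  qed simp
  finally show ?thesis ..
qed

text \<open>Expanding the powers gives a sum over maps \<open>g\<close> from \<open>A\<close> to
  \<open>A\<close>, weighted by the alternating sum over all \<open>S\<close> that contain the image
  of \<open>g\<close>. This weight vanishes unless \<open>g\<close> is onto, hence bijective because
  \<open>A\<close> is finite, and all \<open>fact (card A)\<close> bijections yield the same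
  product.\<close>

lemma polarization:
  fixes L :: "'i \<Rightarrow> 'a::comm_ring_1"
  assumes "finite A"
  shows "of_nat (fact (card A)) * (\<Prod>i\<in>A. L i) = (\<Sum>S\<in>Pow A. (-1) ^ card (A - S) * (\<Sum>i\<in>S. L i) ^ card A)"
proof -
  let ?c = "\<lambda>S. (-1) ^ card (A - S) :: 'a"
  have "(\<Sum>i\<in>S. L i) ^ card A = (\<Sum>g\<in>A \<rightarrow>\<^sub>E A. if g ` A \<subseteq> S then \<Prod>a\<in>A. L (g a) else 0)"
    if "S \<subseteq> A" for S
  proof -
    have "(\<Sum>i\<in>S. L i) ^ card A = (\<Prod>a\<in>A. \<Sum>i\<in>S. L i)" by simp
    also have "\<dots> = (\<Sum>g\<in>A \<rightarrow>\<^sub>E S. \<Prod>a\<in>A. L (g a))"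
      using assms that finite_subset by (intro prod_sum_PiE) auto
    also have "A \<rightarrow>\<^sub>E S = {g \<in> A \<rightarrow>\<^sub>E A. g ` A \<subseteq> S}" using that by (auto simp: PiE_def)
    finally show ?thesis using assms by (simp add: sum.inter_filter finite_PiE)
  qed
  then have "(\<Sum>S\<in>Pow A. ?c S * (\<Sum>i\<in>S. L i) ^ card A) =
      (\<Sum>S\<in>Pow A. \<Sum>g\<in>A \<rightarrow>\<^sub>E A. (if g ` A \<subseteq> S then ?c S else 0) * (\<Prod>a\<in>A. L (g a)))"
    by (intro sum.cong) (auto simp: sum_distrib_left intro!: sum.cong)
  also have "\<dots> = (\<Sum>g\<in>A \<rightarrow>\<^sub>E A. (\<Sum>S\<in>Pow A. if g ` A \<subseteq> S then ?c S else 0) * (\<Prod>a\<in>A. L (g a)))"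
    by (subst sum.swap) (simp add: sum_distrib_right)
  also have "\<dots> = (\<Sum>g\<in>A \<rightarrow>\<^sub>E A. if bij_betw g A A then \<Prod>a\<in>A. L (g a) else 0)"
  proof (rule sum.cong)
    fix g assume "g \<in> A \<rightarrow>\<^sub>E A"
    then have "g ` A \<subseteq> A" "g ` A = A \<longleftrightarrow> bij_betw g A A"
      using assms by (auto simp: bij_betw_def eq_card_imp_inj_on)
    with assms show "(\<Sum>S\<in>Pow A. if g ` A \<subseteq> S then ?c S else 0) * (\<Prod>a\<in>A. L (g a)) =
        (if bij_betw g A A then \<Prod>a\<in>A. L (g a) else 0)"
      by (simp add: alternating_sum_supersets)
  qed simp
  also have "\<dots> = (\<Sum>g | g \<in> A \<rightarrow>\<^sub>E A \<and> bij_betw g A A. \<Prod>a\<in>A. L (g a))"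
    using assms by (simp add: sum.inter_filter finite_PiE)
  also have "\<dots> = (\<Sum>g | g \<in> A \<rightarrow>\<^sub>E A \<and> bij_betw g A A. \<Prod>a\<in>A. L a)"
    by (intro sum.cong) (auto intro!: prod.reindex_bij_betw)
  also have "\<dots> = of_nat (card {g \<in> A \<rightarrow>\<^sub>E A. bij_betw g A A}) * (\<Prod>a\<in>A. L a)" by simp
  also have "card {g \<in> A \<rightarrow>\<^sub>E A. bij_betw g A A} = fact (card A)"
    using bij_betw_same_card[OF bij_betw_restrict_permutes[of A]] card_permutations[OF refl assms] by simp
  finally show ?thesis by simp
qed

subsection \<open>Gaussian moments\<close>

definition gauss_moment :: "nat \<Rightarrow> real \<Rightarrow> real \<Rightarrow> real" where
  "gauss_moment k a b =
     fact k * (fps_exp 1 oo (fps_const a * fps_X + fps_const (1/2 * b) * fps_X ^ 2)) $ k"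

text \<open>The equation F' = (a + b t) F expresses each coefficient by the two before it, so
  together with F(0) = 1 it has a single solution. The generating function of the moments satisfies
  it by the chain rule.\<close>

lemma gauss_moment_unique:
  fixes F :: "real fps"
  assumes "F $ 0 = 1" "fps_deriv F = (fps_const a + fps_const b * fps_X) * F"
  shows "gauss_moment k a b = fact k * F $ k"
proof -
  let ?g = "fps_const a * fps_X + fps_const (1/2 * b) * fps_X ^ 2 :: real fps"
  let ?H = "fps_exp 1 oo ?g"
  have H: "fps_deriv ?H = (fps_const a + fps_const b * fps_X) * ?H"
    by (subst fps_compose_deriv)
      (simp_all add: fps_deriv_power power2_eq_square mult_ac flip: fps_const_mult)
  \<comment> \<open>For \<open>k = 0\<close> the term with \<open>b\<close> is absent; truncated
    subtraction would wrongly put \<open>G $ 0\<close> in its place.\<close>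
  have rec: "G $ Suc k = (a * G $ k + b * (if k = 0 then 0 else G $ (k - 1))) / of_nat (Suc k)"
    if "fps_deriv G = (fps_const a + fps_const b * fps_X) * G" for G :: "real fps" and k
    using arg_cong[OF that, of "\<lambda>f. fps_nth f k"] by (simp add: algebra_simps field_simps)
  have "?H $ k = F $ k"
  proof (induction k rule: less_induct)
    case (less k)
    show ?case
    proof (cases k)
      case 0
      then show ?thesis using assms by simp
    next
      case (Suc j)
      then show ?thesis using less rec[OF H, of j] rec[OF assms(2), of j] by simp
    qed
  qed
  then show ?thesis by (simp add: gauss_moment_def)
qed

lemma gauss_moment_0_0: "gauss_moment k 0 0 = 0 ^ k"
  by (subst gauss_moment_unique[of 1]) (auto simp: power_0_left)

text \<open>Writing x = \<mu> + (x - \<mu>) and expanding binomially reduces the claim to central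
  moments. The resulting convolution is a coefficient of exp(\<mu> t) times their exponential
  generating function, and this product solves the equation of
  \<open>gauss_moment_unique\<close>.\<close>

lemma has_bochner_integral_normal_power:
  assumes \<sigma>: "0 < \<sigma>"
  shows "has_bochner_integral lborel (\<lambda>x. normal_density \<mu> \<sigma> x * x ^ k) (gauss_moment k \<mu> (\<sigma>\<^sup>2))"
proof -
  \<comment> \<open>The central moments, zero for odd index; \<open>H\<close> below is their
    exponential generating function.\<close>
  define c where "c i = (if even i then fact i * (\<sigma>\<^sup>2 / 2) ^ (i div 2) / fact (i div 2) else 0)" for i :: nat
  define H :: "real fps" where "H = Abs_fps (\<lambda>i. c i / fact i)"
  have central: "has_bochner_integral lborel (\<lambda>x. normal_density \<mu> \<sigma> x * (x - \<mu>) ^ i) (c i)" for i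
  proof (cases "even i")
    case True
    then show ?thesis using normal_moment_even[OF \<sigma>, of \<mu> "i div 2"] by (simp add: c_def power_divide)
  next
    case False
    then obtain j where "i = 2 * j + 1" by (elim oddE)
    then show ?thesis using normal_moment_odd[OF \<sigma>, of \<mu> j] by (simp add: c_def)
  qed
  \<comment> \<open>This recursion is the coefficientwise form of H' = \<sigma>^2 t H.\<close>
  have c_rec: "c (Suc (Suc i)) = \<sigma>\<^sup>2 * of_nat (Suc i) * c i" for i
  proof (cases "even i")
    case True
    then obtain b where b: "i = 2 * b" by (elim evenE)
    have "real (Suc b) * 2 = real (Suc (Suc i))" using b by simp
    then show ?thesis
      using b by (simp add: c_def divide_simps del: of_nat_Suc)
  next
    case False
    then show ?thesis by (simp add: c_def)
  qed
  have "fps_nth (fps_deriv H) i = fps_nth (fps_const (\<sigma>\<^sup>2) * fps_X * H) i" for i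
  proof (cases i)
    case 0
    then show ?thesis by (simp add: H_def c_def mult.assoc)
  next
    case (Suc j)
    then show ?thesis using c_rec[of j] by (simp add: H_def mult.assoc field_simps del: of_nat_Suc)
  qed
  then have H: "fps_deriv H = fps_const (\<sigma>\<^sup>2) * fps_X * H" by (intro fps_ext)
  have "gauss_moment k \<mu> (\<sigma>\<^sup>2) = fact k * fps_nth (fps_exp \<mu> * H) k"
    by (rule gauss_moment_unique) (simp_all add: H algebra_simps, simp add: H_def c_def)
  also have "\<dots> = (\<Sum>i\<le>k. of_nat (k choose i) * \<mu> ^ i * c (k - i))"
    by (auto simp: fps_mult_nth sum_distrib_left H_def binomial_fact atLeast0AtMost intro!: sum.cong)
  finally have m: "gauss_moment k \<mu> (\<sigma>\<^sup>2) = (\<Sum>i\<le>k. of_nat (k choose i) * \<mu> ^ i * c (k - i))" .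
  have "(\<lambda>x. normal_density \<mu> \<sigma> x * x ^ k) =
      (\<lambda>x. \<Sum>i\<le>k. of_nat (k choose i) * \<mu> ^ i * (normal_density \<mu> \<sigma> x * (x - \<mu>) ^ (k - i)))"
  proof
    fix x
    have "x ^ k = (\<mu> + (x - \<mu>)) ^ k" by simp
    also have "\<dots> = (\<Sum>i\<le>k. of_nat (k choose i) * \<mu> ^ i * (x - \<mu>) ^ (k - i))"
      by (rule binomial_ring)
    finally show "normal_density \<mu> \<sigma> x * x ^ k =
        (\<Sum>i\<le>k. of_nat (k choose i) * \<mu> ^ i * (normal_density \<mu> \<sigma> x * (x - \<mu>) ^ (k - i)))"
      by (simp add: sum_distrib_left mult_ac)
  qed
  then show ?thesis
    unfolding m by (auto intro!: has_bochner_integral_sum has_bochner_integral_mult_right central)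
qed

lemma distributed_normal_power:
  assumes "distributed N lborel Y (normal_density \<mu> \<sigma>)" "0 < \<sigma>"
  shows "has_bochner_integral N (\<lambda>\<omega>. Y \<omega> ^ k) (gauss_moment k \<mu> (\<sigma>\<^sup>2))"
  using has_bochner_integral_normal_power[OF assms(2), of \<mu> k]
    distributed_integrable[OF assms(1), of "\<lambda>x. x ^ k"] distributed_integral[OF assms(1), of "\<lambda>x. x ^ k"]
  by (simp add: has_bochner_integral_iff)

text \<open>By polarization, the mean of a product of jointly Gaussian variables with means \<open>a\<close> and
  covariances \<open>B\<close>.\<close>

definition gauss_prod_moment :: "'i set \<Rightarrow> ('i \<Rightarrow> real) \<Rightarrow> ('i \<Rightarrow> 'i \<Rightarrow> real) \<Rightarrow> real" where
  "gauss_prod_moment A a B = (\<Sum>S\<in>Pow A. (-1) ^ card (A - S) *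
     gauss_moment (card A) (\<Sum>i\<in>S. a i) (\<Sum>i\<in>S. \<Sum>j\<in>S. B i j)) / fact (card A)"

lemma gauss_prod_moment_cong:
  assumes "\<And>i. i \<in> A \<Longrightarrow> a i = a' i" "\<And>i j. i \<in> A \<Longrightarrow> j \<in> A \<Longrightarrow> B i j = B' i j"
  shows "gauss_prod_moment A a B = gauss_prod_moment A a' B'"
proof -
  have "(\<Sum>i\<in>S. a i) = (\<Sum>i\<in>S. a' i)" "(\<Sum>i\<in>S. \<Sum>j\<in>S. B i j) = (\<Sum>i\<in>S. \<Sum>j\<in>S. B' i j)" if "S \<subseteq> A" for S
    using assms that by (auto intro!: sum.cong)
  then show ?thesis by (simp add: gauss_prod_moment_def)
qed

text \<open>Polarization holds pointwise, so the moments of the partial sums suffice and no joint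
  density of the \<open>Y i\<close> enters.\<close>

lemma has_bochner_integral_gauss_prod:
  fixes Y :: "'i \<Rightarrow> 'w \<Rightarrow> real"
  assumes "finite A"
    and "\<And>S. S \<subseteq> A \<Longrightarrow> has_bochner_integral N (\<lambda>\<omega>. (\<Sum>i\<in>S. Y i \<omega>) ^ card A)
           (gauss_moment (card A) (\<Sum>i\<in>S. a i) (\<Sum>i\<in>S. \<Sum>j\<in>S. B i j))"
  shows "has_bochner_integral N (\<lambda>\<omega>. \<Prod>i\<in>A. Y i \<omega>) (gauss_prod_moment A a B)"
proof -
  have "(\<lambda>\<omega>. \<Prod>i\<in>A. Y i \<omega>) =
      (\<lambda>\<omega>. (\<Sum>S\<in>Pow A. (-1) ^ card (A - S) * (\<Sum>i\<in>S. Y i \<omega>) ^ card A) / fact (card A))"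
  proof
    fix \<omega>
    show "(\<Prod>i\<in>A. Y i \<omega>) = (\<Sum>S\<in>Pow A. (-1) ^ card (A - S) * (\<Sum>i\<in>S. Y i \<omega>) ^ card A) / fact (card A)"
      using polarization[OF assms(1), of "\<lambda>i. Y i \<omega>"] by (simp add: field_simps)
  qed
  then show ?thesis
    unfolding gauss_prod_moment_def
    by (auto intro!: has_bochner_integral_divide_zero has_bochner_integral_sum
        has_bochner_integral_mult_right assms)
qed

section \<open>Linear forms in the entries of a matrix, real or umbral, and their
  covariances\<close>

definition matrix_form :: "nat \<Rightarrow> nat \<Rightarrow> (nat \<Rightarrow> nat \<Rightarrow> 'a::comm_ring_1) \<Rightarrow> 'a mat \<Rightarrow> 'a" where
  "matrix_form p n z X = (\<Sum>j<n. \<Sum>i<p. z i j * X $$ (i, j))"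

text \<open>The covariance of the forms with coefficients \<open>z\<close> and \<open>z'\<close>
  when the columns are independent with covariance \<Sigma>. Distinct columns contribute nothing,
  which is why a single column index occurs.\<close>

definition cov_form ::
    "nat \<Rightarrow> nat \<Rightarrow> real mat \<Rightarrow> (nat \<Rightarrow> nat \<Rightarrow> real) \<Rightarrow> (nat \<Rightarrow> nat \<Rightarrow> real) \<Rightarrow> real" where
  "cov_form p n \<Sigma> z z' = (\<Sum>j<n. \<Sum>i<p. \<Sum>k<p. z i j * \<Sigma> $$ (i, k) * z' k j)"

lemma matrix_form_sum: "matrix_form p n (\<lambda>i j. \<Sum>s\<in>S. z s i j) X = (\<Sum>s\<in>S. matrix_form p n (z s) X)"
  unfolding matrix_form_def sum_distrib_right
  by (subst sum.swap, rule sum.cong[OF refl], subst sum.swap) simp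

lemma cov_form_sum:
  "cov_form p n \<Sigma> (\<lambda>i j. \<Sum>s\<in>S. z s i j) (\<lambda>i j. \<Sum>s\<in>S. z s i j) =
     (\<Sum>s\<in>S. \<Sum>t\<in>S. cov_form p n \<Sigma> (z s) (z t))"
proof -
  have "cov_form p n \<Sigma> (\<lambda>i j. \<Sum>s\<in>S. z s i j) w = (\<Sum>s\<in>S. cov_form p n \<Sigma> (z s) w)" for w
    unfolding cov_form_def sum_distrib_right
    by (simp add: sum.swap[of _ _ S])
  moreover have "cov_form p n \<Sigma> w (\<lambda>i j. \<Sum>s\<in>S. z s i j) = (\<Sum>s\<in>S. cov_form p n \<Sigma> w (z s))" for w
    unfolding cov_form_def sum_distrib_left
    by (simp add: sum.swap[of _ _ S])
  ultimately show ?thesis by simp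
qed

lemma scalar_prod_mult_mat_vec:
  assumes "\<Sigma> \<in> carrier_mat p p"
  shows "Matrix.vec p x \<bullet> (\<Sigma> *\<^sub>v Matrix.vec p y) = (\<Sum>i<p. \<Sum>k<p. x i * \<Sigma> $$ (i, k) * y k)"
  using assms by (simp add: scalar_prod_def sum_distrib_left mult.assoc lessThan_atLeast0)

text \<open>The form is a sum of independent normal variables, one for each column, hence normal
  with added means and variances. Columns with zero coefficient vector are removed first, since
  \<open>gaussian_vector\<close> provides a density only for nonzero vectors.\<close>

lemma gaussian_matrix_form_power:
  assumes X: "gaussian_matrix \<Omega> p n M \<Sigma> X"
    and M: "M \<in> carrier_mat p n" and \<Sigma>: "\<Sigma> \<in> carrier_mat p p"
    and pos: "\<And>v. v \<in> carrier_vec p \<Longrightarrow> v \<noteq> 0\<^sub>v p \<Longrightarrow> 0 < v \<bullet> (\<Sigma> *\<^sub>v v)"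
  shows "has_bochner_integral \<Omega> (\<lambda>\<omega>. matrix_form p n z (X \<omega>) ^ k)
           (gauss_moment k (matrix_form p n z M) (cov_form p n \<Sigma> z z))"
proof -
  interpret prob_space \<Omega> using X by (simp add: gaussian_matrix_def)
  define v where "v j = Matrix.vec p (\<lambda>i. z i j)" for j
  define J where "J = {j. j < n \<and> v j \<noteq> 0\<^sub>v p}"
  define Y where "Y j \<omega> = (\<Sum>i<p. z i j * X \<omega> $$ (i, j))" for j \<omega>
  have X_carrier: "X \<omega> \<in> carrier_mat p n" if "\<omega> \<in> space \<Omega>" for \<omega>
    using X that by (simp add: gaussian_matrix_def)
  have v: "v j \<in> carrier_vec p" for j by (simp add: v_def)
  have vz: "z i j = 0" if "j < n" "j \<notin> J" "i < p" for i j
  proof -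
    have "v j = 0\<^sub>v p" using that by (simp add: J_def)
    then have "v j $ i = 0\<^sub>v p $ i" by simp
    with that show ?thesis by (simp add: v_def)
  qed
  have YJ: "matrix_form p n z A = (\<Sum>j\<in>J. \<Sum>i<p. z i j * A $$ (i, j))" for A
    unfolding matrix_form_def using vz by (intro sum.mono_neutral_right) (auto simp: J_def)
  have CJ: "cov_form p n \<Sigma> z z = (\<Sum>j\<in>J. v j \<bullet> (\<Sigma> *\<^sub>v v j))"
    unfolding cov_form_def v_def scalar_prod_mult_mat_vec[OF \<Sigma>]
    using vz by (intro sum.mono_neutral_right) (auto simp: J_def)
  show ?thesis
  proof (cases "J = {}")
    \<comment> \<open>Without a nonzero column the form is identically zero and has no density. Its
      powers \<open>0 ^ k\<close> are integrated directly, with \<open>0 ^ 0 = 1\<close> giving the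
      total mass one.\<close>
    case True
    then show ?thesis
      by (simp add: YJ CJ gauss_moment_0_0 has_bochner_integral_iff prob_space)
  next
    case False
    have sq: "0 < v j \<bullet> (\<Sigma> *\<^sub>v v j)" if "j \<in> J" for j
      using that v pos by (simp add: J_def)
    have dist: "distributed \<Omega> lborel (Y j) (normal_density (\<Sum>i<p. z i j * M $$ (i, j)) (sqrt (v j \<bullet> (\<Sigma> *\<^sub>v v j))))"
      if "j \<in> J" for j
    proof -
      have j: "j < n" "v j \<noteq> 0\<^sub>v p" using that by (auto simp: J_def)
      then have "distributed \<Omega> lborel (\<lambda>\<omega>. v j \<bullet> col (X \<omega>) j)
          (normal_density (v j \<bullet> col M j) (sqrt (v j \<bullet> (\<Sigma> *\<^sub>v v j))))"
        using X v by (simp add: gaussian_matrix_def gaussian_vector_def)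
      moreover have vcol: "v j \<bullet> col A j = (\<Sum>i<p. z i j * A $$ (i, j))" if "A \<in> carrier_mat p n" for A
        using that j by (simp add: scalar_prod_def v_def lessThan_atLeast0)
      moreover have "v j \<bullet> col (X \<omega>) j = Y j \<omega>" if "\<omega> \<in> space \<Omega>" for \<omega>
        using vcol[OF X_carrier[OF that]] by (simp add: Y_def)
      ultimately show ?thesis
        using M by (simp add: distributed_def cong: distr_cong measurable_cong)
    qed
    have ind: "indep_vars (\<lambda>j. borel) Y J"
    proof -
      have "indep_vars (\<lambda>j. Pi\<^sub>M {..<p} (\<lambda>i. borel)) (\<lambda>j \<omega>. \<lambda>i\<in>{..<p}. X \<omega> $$ (i, j)) J"
        using X by (auto simp: gaussian_matrix_def J_def intro: indep_vars_subset)
      then have "indep_vars (\<lambda>j. borel) (\<lambda>j \<omega>. (\<lambda>h. \<Sum>i<p. z i j * h i) (\<lambda>i\<in>{..<p}. X \<omega> $$ (i, j))) J"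
        by (rule indep_vars_compose2) measurable
      then show ?thesis unfolding Y_def by simp
    qed
    have var: "(\<Sum>j\<in>J. (sqrt (v j \<bullet> (\<Sigma> *\<^sub>v v j)))\<^sup>2) = (\<Sum>j\<in>J. v j \<bullet> (\<Sigma> *\<^sub>v v j))"
      using sq by (intro sum.cong) (auto simp: less_imp_le)
    have "distributed \<Omega> lborel (\<lambda>\<omega>. \<Sum>j\<in>J. Y j \<omega>) (normal_density (\<Sum>j\<in>J. \<Sum>i<p. z i j * M $$ (i, j))
        (sqrt (\<Sum>j\<in>J. (sqrt (v j \<bullet> (\<Sigma> *\<^sub>v v j)))\<^sup>2)))"
      using False sq dist by (intro sum_indep_normal ind) (auto simp: J_def)
    moreover have "0 < (\<Sum>j\<in>J. v j \<bullet> (\<Sigma> *\<^sub>v v j))"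
      using False sq by (intro sum_pos) (auto simp: J_def)
    ultimately show ?thesis
      unfolding var YJ CJ using distributed_normal_power by (fastforce simp: Y_def)
  qed
qed

text \<open>A sum of forms is again a form, with added coefficients, so the partial sums demanded by
  polarization are covered by \<open>gaussian_matrix_form_power\<close>.\<close>

lemma gaussian_matrix_form_prod:
  assumes "gaussian_matrix \<Omega> p n M \<Sigma> X"
    and "M \<in> carrier_mat p n" and "\<Sigma> \<in> carrier_mat p p"
    and "\<And>v. v \<in> carrier_vec p \<Longrightarrow> v \<noteq> 0\<^sub>v p \<Longrightarrow> 0 < v \<bullet> (\<Sigma> *\<^sub>v v)"
    and "finite A"
  shows "has_bochner_integral \<Omega> (\<lambda>\<omega>. \<Prod>s\<in>A. matrix_form p n (z s) (X \<omega>))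
           (gauss_prod_moment A (\<lambda>s. matrix_form p n (z s) M) (\<lambda>s t. cov_form p n \<Sigma> (z s) (z t)))"
  using assms(5)
proof (rule has_bochner_integral_gauss_prod)
  fix S assume "S \<subseteq> A"
  show "has_bochner_integral \<Omega> (\<lambda>\<omega>. (\<Sum>s\<in>S. matrix_form p n (z s) (X \<omega>)) ^ card A)
      (gauss_moment (card A) (\<Sum>s\<in>S. matrix_form p n (z s) M)
        (\<Sum>s\<in>S. \<Sum>t\<in>S. cov_form p n \<Sigma> (z s) (z t)))"
    using gaussian_matrix_form_power[OF assms(1-4), of "\<lambda>i j. \<Sum>s\<in>S. z s i j" "card A"]
    by (simp add: matrix_form_sum cov_form_sum)
qed

subsection \<open>Umbral evaluation\<close>

lemma poly_mapping_eq_sum_single: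
  "f = (\<Sum>k\<in>Poly_Mapping.keys f. Poly_Mapping.single k (Poly_Mapping.lookup f k))"
  by (rule poly_mapping_eqI) (auto simp: lookup_sum lookup_single when_def in_keys_iff)

lemma uconst_add: "uconst (a + b) = uconst a + uconst b"
  by (simp add: uconst_def single_add)

lemma uconst_mult: "uconst (a * b) = uconst a * uconst b"
  by (simp add: uconst_def mult_single)

lemma uconst_0: "uconst 0 = 0"
  by (simp add: uconst_def)

lemma uconst_1: "uconst 1 = 1"
  by (simp add: uconst_def)

lemma uconst_minus: "uconst (- a) = - uconst a"
  by (simp add: uconst_def single_uminus)

lemma uconst_sum: "uconst (\<Sum>i\<in>A. f i) = (\<Sum>i\<in>A. uconst (f i))"
  by (induction A rule: infinite_finite_induct) (simp_all add: uconst_add uconst_0)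

lemma uconst_of_nat: "uconst (of_nat k) = of_nat k"
  by (simp add: uconst_def)

lemma umbra_power: "umbra \<alpha> ^ k = Poly_Mapping.single (Poly_Mapping.single \<alpha> k) 1"
  by (induction k) (simp_all add: umbra_def mult_single flip: single_add)

text \<open>This reduces the evaluation of any polynomial, by linearity, to products of powers of
  distinct umbrae, the products on which \<open>umbral_evaluation\<close> is multiplicative.\<close>

lemma single_monomial: "Poly_Mapping.single \<mu> c =
  uconst c * (\<Prod>\<alpha>\<in>Poly_Mapping.keys \<mu>. umbra \<alpha> ^ Poly_Mapping.lookup \<mu> \<alpha>)"
proof -
  have "(\<Prod>\<alpha>\<in>A. umbra \<alpha> ^ k \<alpha>) = Poly_Mapping.single (\<Sum>\<alpha>\<in>A. Poly_Mapping.single \<alpha> (k \<alpha>)) 1"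
    for A :: "'a set" and k
    by (induction A rule: infinite_finite_induct) (simp_all add: umbra_power mult_single)
  then show ?thesis
    by (simp add: uconst_def mult_single flip: poly_mapping_eq_sum_single)
qed

lemma umbrae_of_add: "umbrae_of (q + r) \<subseteq> umbrae_of q \<union> umbrae_of r"
  using Poly_Mapping.keys_add[of q r] by (auto simp: umbrae_of_def)

lemma umbrae_of_mult: "umbrae_of (q * r) \<subseteq> umbrae_of q \<union> umbrae_of r"
proof
  fix \<alpha> assume "\<alpha> \<in> umbrae_of (q * r)"
  then obtain \<mu> where \<mu>: "\<mu> \<in> Poly_Mapping.keys (q * r)" "\<alpha> \<in> Poly_Mapping.keys \<mu>"
    by (auto simp: umbrae_of_def)
  with Poly_Mapping.keys_mult[of q r] obtain a b
    where "a \<in> Poly_Mapping.keys q" "b \<in> Poly_Mapping.keys r" "\<mu> = a + b" by auto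
  with \<mu> Poly_Mapping.keys_add[of a b] show "\<alpha> \<in> umbrae_of q \<union> umbrae_of r"
    by (auto simp: umbrae_of_def)
qed

lemma umbrae_of_uconst: "umbrae_of (uconst c) = {}"
  by (simp add: umbrae_of_def uconst_def)

lemma umbrae_of_sum: "umbrae_of (\<Sum>i\<in>A. f i) \<subseteq> (\<Union>i\<in>A. umbrae_of (f i))"
proof (induction A rule: infinite_finite_induct)
  case (insert x A)
  then show ?case using umbrae_of_add[of "f x" "sum f A"] by auto
qed (simp_all add: umbrae_of_def)

lemma umbrae_of_prod: "umbrae_of (\<Prod>i\<in>A. f i) \<subseteq> (\<Union>i\<in>A. umbrae_of (f i))"
proof (induction A rule: infinite_finite_induct)
  case (insert x A)
  then show ?case using umbrae_of_mult[of "f x" "prod f A"] by auto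
qed (simp_all add: umbrae_of_def)

section \<open>Stacked columns and the Kronecker quadratic form\<close>

lemma sum_mod_div:
  fixes f :: "nat \<Rightarrow> nat \<Rightarrow> 'a::comm_monoid_add"
  shows "(\<Sum>k<p * n. f (k mod p) (k div p)) = (\<Sum>j<n. \<Sum>i<p. f i j)"
proof (induction n)
  case (Suc n)
  \<comment> \<open>The last column occupies the \<open>p\<close> indices starting at
    \<open>p * n\<close>.\<close>
  have "(\<Sum>k<p * Suc n. f (k mod p) (k div p)) =
      (\<Sum>k<p * n. f (k mod p) (k div p)) + (\<Sum>k=p*n..<p*n+p. f (k mod p) (k div p))"
    by (simp add: lessThan_atLeast0 sum.atLeastLessThan_concat add.commute)
  also have "(\<Sum>k=p*n..<p*n+p. f (k mod p) (k div p)) = (\<Sum>i<p. f i n)"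
    using sum.shift_bounds_nat_ivl[of "\<lambda>k. f (k mod p) (k div p)" 0 "p * n" p]
    by (simp add: lessThan_atLeast0 add.commute)
  finally show ?case using Suc by simp
qed simp

lemma vec_of_mat_scalar_prod:
  assumes "A \<in> carrier_mat p n" "B \<in> carrier_mat p n"
  shows "vec_of_mat A \<bullet> vec_of_mat B = (\<Sum>j<n. \<Sum>i<p. A $$ (i, j) * B $$ (i, j))"
proof -
  have "vec_of_mat A \<bullet> vec_of_mat B =
      (\<Sum>k<p * n. A $$ (k mod p, k div p) * B $$ (k mod p, k div p))"
    using assms by (simp add: scalar_prod_def vec_of_mat_def lessThan_atLeast0)
  then show ?thesis
    using sum_mod_div[of "\<lambda>i j. A $$ (i, j) * B $$ (i, j)" p n] by simp
qed

text \<open>An entry of the Kronecker product of the identity with \<Sigma> vanishes unless both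
  indices lie in the same column block. This turns the exponent of
  \<open>normal_umbral_matrix\<close> into a \<open>cov_form\<close>.\<close>

lemma kronecker_one_quadratic_form:
  assumes Z: "Z \<in> carrier_mat p n" and \<Sigma>: "\<Sigma> \<in> carrier_mat p p"
  shows "vec_of_mat Z \<bullet> (kronecker (1\<^sub>m n) \<Sigma> *\<^sub>v vec_of_mat Z) =
    cov_form p n \<Sigma> (\<lambda>i j. Z $$ (i, j)) (\<lambda>i j. Z $$ (i, j))"
proof -
  let ?z = "\<lambda>k. Z $$ (k mod p, k div p)"
  have "vec_of_mat Z \<bullet> (kronecker (1\<^sub>m n) \<Sigma> *\<^sub>v vec_of_mat Z) =
      (\<Sum>k<p * n. \<Sum>l<p * n. ?z k * ((if k div p = l div p then \<Sigma> $$ (k mod p, l mod p) else 0) * ?z l))"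
    using assms
    by (auto simp: scalar_prod_def vec_of_mat_def kronecker_def lessThan_atLeast0 sum_distrib_left
        mult.commute[of n] less_mult_imp_div_less intro!: sum.cong)
  also have "\<dots> = (\<Sum>j<n. \<Sum>i<p. \<Sum>l<p * n.
      Z $$ (i, j) * ((if j = l div p then \<Sigma> $$ (i, l mod p) else 0) * ?z l))"
    using sum_mod_div[of "\<lambda>i j. \<Sum>l<p * n. Z $$ (i, j) * ((if j = l div p then \<Sigma> $$ (i, l mod p) else 0) * ?z l)" p n]
    by simp
  also have "\<dots> = (\<Sum>j<n. \<Sum>i<p. \<Sum>j'<n. \<Sum>k<p.
      Z $$ (i, j) * ((if j = j' then \<Sigma> $$ (i, k) else 0) * Z $$ (k, j')))"
    using sum_mod_div[of "\<lambda>k j'. Z $$ (_, _) * ((if _ = j' then \<Sigma> $$ (_, k) else 0) * Z $$ (k, j'))" p n]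
    by simp
  also have "\<dots> = cov_form p n \<Sigma> (\<lambda>i j. Z $$ (i, j)) (\<lambda>i j. Z $$ (i, j))"
  proof -
    have "(\<Sum>j'<n. \<Sum>k<p. Z $$ (i, j) * ((if j = j' then \<Sigma> $$ (i, k) else 0) * Z $$ (k, j'))) =
        (\<Sum>k<p. Z $$ (i, j) * \<Sigma> $$ (i, k) * Z $$ (k, j))" if "j < n" for i j
    proof -
      have "(\<Sum>j'<n. \<Sum>k<p. Z $$ (i, j) * ((if j = j' then \<Sigma> $$ (i, k) else 0) * Z $$ (k, j'))) =
          (\<Sum>j'<n. if j = j' then \<Sum>k<p. Z $$ (i, j) * \<Sigma> $$ (i, k) * Z $$ (k, j') else 0)"
        by (intro sum.cong) (auto simp: mult.assoc)
      with that show ?thesis by simp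
    qed
    then show ?thesis by (simp add: cov_form_def)
  qed
  finally show ?thesis .
qed

lemma mat_trace_transpose_mult:
  assumes "A \<in> carrier_mat p n" "B \<in> carrier_mat p n"
  shows "mat_trace (transpose_mat A * B) = (\<Sum>j<n. \<Sum>i<p. A $$ (i, j) * B $$ (i, j))"
  using assms by (simp add: mat_trace_def scalar_prod_def lessThan_atLeast0)

section \<open>Evaluation of delta umbrae and of normal forms\<close>

context
  fixes E :: "'u umbral_poly \<Rightarrow> real"
  assumes eval: "umbral_evaluation E"
begin

lemma E_add: "E (q + r) = E q + E r"
  using eval by (simp add: umbral_evaluation_def)

lemma E_scale: "E (uconst c * q) = c * E q"
  using eval by (simp add: umbral_evaluation_def)

lemma E_0: "E 0 = 0"
  using E_scale[of 0 0] by simp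

lemma E_sum: "E (\<Sum>i\<in>A. f i) = (\<Sum>i\<in>A. E (f i))"
  by (induction A rule: infinite_finite_induct) (simp_all add: E_0 E_add)

lemma E_prod_umbra:
  "finite A \<Longrightarrow> E (\<Prod>\<alpha>\<in>A. umbra \<alpha> ^ k \<alpha>) = (\<Prod>\<alpha>\<in>A. E (umbra \<alpha> ^ k \<alpha>))"
  using eval by (simp add: umbral_evaluation_def)

text \<open>By linearity \<open>q\<close> may be taken to be a monomial. Having no umbra in
  \<open>D\<close>, it combines with the powers over \<open>D\<close> to a product of powers of
  distinct umbrae, which the evaluation splits.\<close>

lemma E_uncorrelated:
  assumes "finite D" "umbrae_of q \<inter> D = {}"
  shows "E ((\<Prod>\<alpha>\<in>D. umbra \<alpha> ^ k \<alpha>) * q) = (\<Prod>\<alpha>\<in>D. E (umbra \<alpha> ^ k \<alpha>)) * E q"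
proof -
  let ?D = "\<Prod>\<alpha>\<in>D. umbra \<alpha> ^ k \<alpha>"
  have monomial: "E (?D * Poly_Mapping.single \<mu> c) =
      (\<Prod>\<alpha>\<in>D. E (umbra \<alpha> ^ k \<alpha>)) * E (Poly_Mapping.single \<mu> c)"
    if "Poly_Mapping.keys \<mu> \<inter> D = {}" for \<mu> c
  proof -
    let ?K = "Poly_Mapping.keys \<mu>"
    let ?k = "\<lambda>\<alpha>. if \<alpha> \<in> D then k \<alpha> else Poly_Mapping.lookup \<mu> \<alpha>"
    \<comment> \<open>Stated for a general \<open>g\<close>, as it is applied both to powers of
      umbrae and to their evaluations.\<close>
    have split: "(\<Prod>\<alpha>\<in>D \<union> ?K. g (?k \<alpha>) \<alpha>) =
        (\<Prod>\<alpha>\<in>D. g (k \<alpha>) \<alpha>) * (\<Prod>\<alpha>\<in>?K. g (Poly_Mapping.lookup \<mu> \<alpha>) \<alpha>)" for g :: "nat \<Rightarrow> 'u \<Rightarrow> 'b::comm_monoid_mult"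
      using that assms(1) by (subst prod.union_disjoint) (auto intro!: arg_cong2[where f = "(*)"] prod.cong)
    have "?D * Poly_Mapping.single \<mu> c = uconst c * (\<Prod>\<alpha>\<in>D \<union> ?K. umbra \<alpha> ^ ?k \<alpha>)"
      using split[of "\<lambda>j \<alpha>. umbra \<alpha> ^ j"] by (simp add: single_monomial[of \<mu> c] mult_ac)
    then show ?thesis
      using split[of "\<lambda>j \<alpha>. E (umbra \<alpha> ^ j)"] assms(1)
      by (simp add: single_monomial[of \<mu> c] E_scale E_prod_umbra mult_ac)
  qed
  have "E (?D * q) = (\<Sum>\<mu>\<in>Poly_Mapping.keys q. E (?D * Poly_Mapping.single \<mu> (Poly_Mapping.lookup q \<mu>)))"
    by (subst poly_mapping_eq_sum_single[of q]) (simp add: sum_distrib_left E_sum)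
  also have "\<dots> = (\<Sum>\<mu>\<in>Poly_Mapping.keys q.
      (\<Prod>\<alpha>\<in>D. E (umbra \<alpha> ^ k \<alpha>)) * E (Poly_Mapping.single \<mu> (Poly_Mapping.lookup q \<mu>)))"
    using assms(2) by (intro sum.cong monomial) (auto simp: umbrae_of_def)
  also have "\<dots> = (\<Prod>\<alpha>\<in>D. E (umbra \<alpha> ^ k \<alpha>)) * E q"
    by (subst (3) poly_mapping_eq_sum_single[of q]) (simp add: sum_distrib_left E_sum)
  finally show ?thesis .
qed

lemma E_delta_power:
  assumes "delta_umbra E \<delta>"
  shows "E (umbra \<delta> ^ k) = (if k = 0 \<or> k = 2 then 1 else 0)"
proof -
  have "fps_nth (umbral_gf E (umbra \<delta>)) k = fps_nth (1 + fps_const (1/2) * fps_X ^ 2) k"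
    using assms by (simp add: delta_umbra_def)
  then show ?thesis by (auto simp: umbral_gf_def split: if_splits)
qed

text \<open>Collecting equal umbrae gives each the exponent \<open>2 * ?N \<alpha>\<close> with
  \<open>?N \<alpha>\<close> its multiplicity. A delta umbra has moment 1 for exponent 2 and moment
  0 for exponents 4, 6 and so on, so a single repetition annihilates the product.\<close>

lemma E_delta_squares:
  assumes "finite K" "\<And>k. k \<in> K \<Longrightarrow> delta_umbra E (c k)" "umbrae_of q \<inter> c ` K = {}"
  shows "E ((\<Prod>k\<in>K. umbra (c k) ^ 2) * q) = (if inj_on c K then E q else 0)"
proof -
  let ?N = "\<lambda>\<alpha>. card {k \<in> K. c k = \<alpha>}"
  have N: "?N \<alpha> \<noteq> 0" if "\<alpha> \<in> c ` K" for \<alpha>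
    using that assms(1) by auto
  have "(\<Prod>k\<in>K. umbra (c k) ^ 2) = (\<Prod>\<alpha>\<in>c ` K. \<Prod>k\<in>{k \<in> K. c k = \<alpha>}. umbra (c k) ^ 2)"
    using assms(1) by (rule prod.image_gen)
  also have "\<dots> = (\<Prod>\<alpha>\<in>c ` K. umbra \<alpha> ^ (2 * ?N \<alpha>))"
    by (intro prod.cong) (simp_all add: power_mult)
  finally have "E ((\<Prod>k\<in>K. umbra (c k) ^ 2) * q) = (\<Prod>\<alpha>\<in>c ` K. E (umbra \<alpha> ^ (2 * ?N \<alpha>))) * E q"
    using assms E_uncorrelated[of "c ` K" q] by simp
  also have "(\<Prod>\<alpha>\<in>c ` K. E (umbra \<alpha> ^ (2 * ?N \<alpha>))) = (\<Prod>\<alpha>\<in>c ` K. if ?N \<alpha> = 1 then 1 else 0)"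
    using assms(2) N by (intro prod.cong) (auto simp: E_delta_power)
  also have "\<dots> = (if inj_on c K then 1 else 0)"
  proof (cases "inj_on c K")
    case True
    have "?N \<alpha> = 1" if \<alpha>: "\<alpha> \<in> c ` K" for \<alpha>
    proof -
      obtain k where "k \<in> K" "\<alpha> = c k" using \<alpha> by blast
      then have "{k \<in> K. c k = \<alpha>} = {k}" using True by (auto dest: inj_onD)
      then show ?thesis by simp
    qed
    with True show ?thesis by simp
  next
    case False
    then obtain k l where kl: "k \<in> K" "l \<in> K" "k \<noteq> l" "c k = c l" by (auto simp: inj_on_def)
    then have "card {k, l} \<le> ?N (c k)" using assms(1) by (intro card_mono) auto
    with kl False assms(1) show ?thesis by (auto intro!: prod_zero bexI[of _ k])
  qed
  finally show ?thesis by simp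
qed

text \<open>The coefficient of degree \<open>k\<close> in the defining identity of the generating
  function, taken at the matrix \<open>Z\<close> of coefficients of the form.\<close>

lemma E_normal_form_power:
  assumes X: "normal_umbral_matrix E p n M \<Sigma> X"
    and M: "M \<in> carrier_mat p n" and \<Sigma>: "\<Sigma> \<in> carrier_mat p p"
  shows "E (matrix_form p n (\<lambda>i j. uconst (z i j)) X ^ k) =
    gauss_moment k (matrix_form p n z M) (cov_form p n \<Sigma> z z)"
proof -
  define Z where "Z = Matrix.mat p n (\<lambda>(i, j). z i j)"
  have Z: "Z \<in> carrier_mat p n" by (simp add: Z_def)
  have X': "X \<in> carrier_mat p n" using X by (simp add: normal_umbral_matrix_def)
  let ?q = "mat_trace (transpose_mat X * map_mat uconst Z)"
  have "?q = matrix_form p n (\<lambda>i j. uconst (z i j)) X"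
    using mat_trace_transpose_mult[OF X', of "map_mat uconst Z"]
    by (simp add: matrix_form_def Z_def mult.commute)
  moreover have "vec_of_mat M \<bullet> vec_of_mat Z = matrix_form p n z M"
    using vec_of_mat_scalar_prod[OF M Z] by (simp add: matrix_form_def Z_def mult.commute)
  moreover have "cov_form p n \<Sigma> (\<lambda>i j. Z $$ (i, j)) (\<lambda>i j. Z $$ (i, j)) = cov_form p n \<Sigma> z z"
    by (simp add: cov_form_def Z_def)
  moreover have "fps_nth (umbral_gf E ?q) k = E (?q ^ k) / fact k"
    by (simp add: umbral_gf_def)
  moreover have "umbral_gf E ?q = fps_exp 1 oo (fps_const (vec_of_mat M \<bullet> vec_of_mat Z) * fps_X +
      fps_const (1/2 * (vec_of_mat Z \<bullet> (kronecker (1\<^sub>m n) \<Sigma> *\<^sub>v vec_of_mat Z))) * fps_X ^ 2)"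
    using X Z by (simp add: normal_umbral_matrix_def)
  ultimately show ?thesis
    using kronecker_one_quadratic_form[OF Z \<Sigma>] by (simp add: gauss_moment_def)
qed

text \<open>The counterpart of \<open>gaussian_matrix_form_prod\<close>: the same polarization with
  the same means and covariances leads to the same value, which identifies umbral and probabilistic
  moments of products.\<close>

lemma E_normal_form_prod:
  assumes "normal_umbral_matrix E p n M \<Sigma> X"
    and "M \<in> carrier_mat p n" and "\<Sigma> \<in> carrier_mat p p" and A: "finite A"
  shows "E (\<Prod>s\<in>A. matrix_form p n (\<lambda>i j. uconst (z s i j)) X) =
    gauss_prod_moment A (\<lambda>s. matrix_form p n (z s) M) (\<lambda>s t. cov_form p n \<Sigma> (z s) (z t))"
proof -
  let ?L = "\<lambda>s. matrix_form p n (\<lambda>i j. uconst (z s i j)) X"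
  have "fact (card A) * E (\<Prod>s\<in>A. ?L s) = E (of_nat (fact (card A)) * (\<Prod>s\<in>A. ?L s))"
    by (simp add: E_scale flip: uconst_of_nat)
  also have "\<dots> = (\<Sum>S\<in>Pow A. E ((-1) ^ card (A - S) * (\<Sum>s\<in>S. ?L s) ^ card A))"
    by (simp only: polarization[OF A] E_sum)
  also have "\<dots> = (\<Sum>S\<in>Pow A. (-1) ^ card (A - S) * E ((\<Sum>s\<in>S. ?L s) ^ card A))"
  proof (rule sum.cong)
    fix S
    \<comment> \<open>Signs have to be written as constants \<open>uconst\<close> before
      \<open>E\<close> lets them out.\<close>
    have "(-1) ^ j = (uconst ((-1) ^ j) :: 'u umbral_poly)" for j
      by (induction j) (simp_all add: uconst_1 uconst_minus)
    then show "E ((-1) ^ card (A - S) * (\<Sum>s\<in>S. ?L s) ^ card A) =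
        (-1) ^ card (A - S) * E ((\<Sum>s\<in>S. ?L s) ^ card A)"
      by (simp add: E_scale)
  qed simp
  also have "\<dots> = (\<Sum>S\<in>Pow A. (-1) ^ card (A - S) * gauss_moment (card A)
      (\<Sum>s\<in>S. matrix_form p n (z s) M) (\<Sum>s\<in>S. \<Sum>t\<in>S. cov_form p n \<Sigma> (z s) (z t)))"
    using E_normal_form_power[OF assms(1-3), of "\<lambda>i j. \<Sum>s\<in>_. z s i j" "card A"]
    by (simp add: uconst_sum matrix_form_sum cov_form_sum)
  finally show ?thesis by (simp add: gauss_prod_moment_def field_simps)
qed

text \<open>Changing the sign of the form \<open>e\<close> preserves all means and covariances but negates the product.\<close>

lemma gauss_prod_moment_eq_0:
  assumes X: "normal_umbral_matrix E p n M \<Sigma> X" "M \<in> carrier_mat p n" "\<Sigma> \<in> carrier_mat p p"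
    and A: "finite A" "e \<in> A" and e: "matrix_form p n (z e) M = 0"
    and cov: "\<And>t. t \<in> A \<Longrightarrow> t \<noteq> e \<Longrightarrow> cov_form p n \<Sigma> (z e) (z t) = 0"
      "\<And>t. t \<in> A \<Longrightarrow> t \<noteq> e \<Longrightarrow> cov_form p n \<Sigma> (z t) (z e) = 0"
  shows "gauss_prod_moment A (\<lambda>s. matrix_form p n (z s) M) (\<lambda>s t. cov_form p n \<Sigma> (z s) (z t)) = 0"
proof -
  define y where "y s = (if s = e then (\<lambda>i j. - z e i j) else z s)" for s
  let ?g = "\<lambda>z. gauss_prod_moment A (\<lambda>s. matrix_form p n (z s) M) (\<lambda>s t. cov_form p n \<Sigma> (z s) (z t))"
  let ?L = "\<lambda>z. matrix_form p n (\<lambda>i j. uconst (z i j)) X"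
  \<comment> \<open>Linearity of \<open>gauss_prod_moment\<close> in the form \<open>e\<close> is
    inherited from the umbral product whose evaluation it is.\<close>
  have "(\<Prod>s\<in>A. ?L (y s)) = ?L (y e) * (\<Prod>s\<in>A - {e}. ?L (y s))"
    using A by (rule prod.remove)
  also have "?L (y e) = - ?L (z e)"
    by (simp add: y_def matrix_form_def uconst_minus sum_negf)
  also have "(\<Prod>s\<in>A - {e}. ?L (y s)) = (\<Prod>s\<in>A - {e}. ?L (z s))"
    by (intro prod.cong) (auto simp: y_def)
  also have "- ?L (z e) * (\<Prod>s\<in>A - {e}. ?L (z s)) = uconst (-1) * (\<Prod>s\<in>A. ?L (z s))"
    by (simp add: prod.remove[OF A] uconst_minus uconst_1)
  finally have "?g y = - ?g z"
    using E_normal_form_prod[OF X A(1), of y] E_normal_form_prod[OF X A(1), of z] by (simp add: E_scale)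
  moreover have "?g y = ?g z"
  proof (rule gauss_prod_moment_cong)
    have neg: "cov_form p n \<Sigma> (\<lambda>i j. - a i j) b = - cov_form p n \<Sigma> a b"
      "cov_form p n \<Sigma> a (\<lambda>i j. - b i j) = - cov_form p n \<Sigma> a b" for a b
      by (simp_all add: cov_form_def sum_negf)
    show "matrix_form p n (y s) M = matrix_form p n (z s) M" for s
      using e by (simp add: y_def matrix_form_def sum_negf)
    \<comment> \<open>For \<open>s = t = e\<close> the two signs cancel; covariances of
      \<open>e\<close> with other forms vanish.\<close>
    show "cov_form p n \<Sigma> (y s) (y t) = cov_form p n \<Sigma> (z s) (z t)" if "s \<in> A" "t \<in> A" for s t
      using cov that by (simp add: y_def neg)
  qed
  ultimately show ?thesis by simp
qed

end

subsection \<open>Determinants and injections\<close>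

text \<open>The characteristic polynomial at 0 is (-1)^p det S, and by its factorization over the
  complex numbers also (-1)^p times the product of the latent roots. Among \<open>p\<close> indices
  only the full set has \<open>p\<close> elements, so \<open>elem_sym p\<close> is that
  product.\<close>

lemma Tr_eq_det:
  assumes "S \<in> carrier_mat p p"
  shows "Tr p S = Determinant.det S"
proof -
  let ?S = "map_mat complex_of_real S"
  have S: "?S \<in> carrier_mat p p" using assms by simp
  interpret comm_ring_hom complex_of_real by unfold_locales auto
  obtain ys where "mset ys = proots (char_poly ?S)" using ex_mset by blast
  then have ys: "mset (latent_roots S) = proots (char_poly ?S)"
    unfolding latent_roots_def by (rule someI)
  let ?y = "latent_roots S"
  have monic: "degree (char_poly ?S) = p" "lead_coeff (char_poly ?S) = 1"
    using degree_monic_char_poly[OF S] by simp_all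
  have len: "length ?y = p"
    using ys size_proots_complex[of "char_poly ?S"] monic by (metis size_mset)
  have "- char_matrix ?S 0 = (-1) \<cdot>\<^sub>m ?S"
    using S by (intro eq_matI) (auto simp: char_matrix_def)
  then have "(-1) ^ p * Determinant.det ?S = poly (char_poly ?S) 0"
    using S by (simp add: char_poly_matrix)
  also have "\<dots> = poly (\<Prod>x\<in>#mset ?y. [:-x, 1:]) 0"
    using complex_poly_decompose_multiset[of "char_poly ?S"] monic ys by simp
  also have "(\<Prod>x\<in>#mset ?y. [:-x, 1:]) = (\<Prod>x\<leftarrow>?y. [:-x, 1:])"
    by (metis mset_map prod_mset_prod_list)
  also have "poly (\<Prod>x\<leftarrow>?y. [:-x, 1:]) 0 = (\<Prod>k<p. - ?y ! k)"
    by (simp add: poly_prod prod.list_conv_set_nth len atLeast0LessThan)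
  also have "\<dots> = (-1) ^ p * (\<Prod>k<p. ?y ! k)"
    by (subst prod_uminus) simp
  finally have "Determinant.det ?S = (\<Prod>k<p. ?y ! k)" by simp
  moreover have "{I. I \<subseteq> {..<p} \<and> card I = p} = {{..<p}}"
    using card_subset_eq[of "{..<p}"] by auto
  ultimately have "elem_sym p ?y = complex_of_real (Determinant.det S)"
    by (simp add: elem_sym_def len)
  then show ?thesis by (simp add: Tr_def)
qed

text \<open>Entries of a transformed matrix are thus linear forms in the original entries, to which
  the moment lemmas apply.\<close>

lemma index_mult_mult_mat:
  assumes "A \<in> carrier_mat p' p" "X \<in> carrier_mat p n" "B \<in> carrier_mat n n'" "i < p'" "j < n'"
  shows "(A * X * B) $$ (i, j) = matrix_form p n (\<lambda>k l. A $$ (i, k) * B $$ (l, j)) X"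
proof -
  have "(A * X * B) $$ (i, j) = (\<Sum>k<p. A $$ (i, k) * (\<Sum>l<n. X $$ (k, l) * B $$ (l, j)))"
    using assms by (simp add: scalar_prod_def lessThan_atLeast0)
  also have "\<dots> = (\<Sum>l<n. \<Sum>k<p. A $$ (i, k) * B $$ (l, j) * X $$ (k, l))"
    by (subst sum.swap) (simp add: sum_distrib_left mult_ac)
  finally show ?thesis by (simp add: matrix_form_def)
qed

section \<open>Expansion of det(G G^T) over injections\<close>

abbreviation injections :: "nat \<Rightarrow> nat \<Rightarrow> (nat \<Rightarrow> nat) set" where
  "injections p n \<equiv> {f \<in> {..<p} \<rightarrow>\<^sub>E {..<n}. inj_on f {..<p}}"

text \<open>The Cauchy-Binet formula before injections are grouped by their image. Distributing the
  Leibniz formula gives all maps \<open>f\<close>; for fixed \<open>f\<close> the sum over \<sigma>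
  is a multiple of the determinant whose rows are the columns \<open>f i\<close> of
  \<open>G\<close>, and two rows agree if \<open>f\<close> is not injective.\<close>

lemma det_mult_transpose:
  fixes G :: "'a::comm_ring_1 mat"
  assumes G: "G \<in> carrier_mat p n"
  shows "Determinant.det (G * transpose_mat G) = (\<Sum>f\<in>injections p n. \<Sum>\<sigma> | \<sigma> permutes {..<p}.
    signof \<sigma> * ((\<Prod>i<p. G $$ (i, f i)) * (\<Prod>i<p. G $$ (\<sigma> i, f i))))"
proof -
  let ?t = "\<lambda>f \<sigma>. signof \<sigma> * ((\<Prod>i<p. G $$ (i, f i)) * (\<Prod>i<p. G $$ (\<sigma> i, f i)))"
  let ?F = "{..<p} \<rightarrow>\<^sub>E {..<n}"
  have "Determinant.det (G * transpose_mat G) =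
      (\<Sum>\<sigma> | \<sigma> permutes {..<p}. signof \<sigma> * (\<Prod>i<p. \<Sum>j<n. G $$ (i, j) * G $$ (\<sigma> i, j)))"
    using G permutes_in_image[of _ "{..<p}"]
    by (subst det_def'[of _ p]) (auto simp: scalar_prod_def lessThan_atLeast0 intro!: sum.cong prod.cong arg_cong2[where f = "(*)"])
  also have "\<dots> = (\<Sum>\<sigma> | \<sigma> permutes {..<p}. \<Sum>f\<in>?F. ?t f \<sigma>)"
    by (subst prod_sum_PiE) (simp_all add: sum_distrib_left prod.distrib)
  also have "\<dots> = (\<Sum>f\<in>?F. \<Sum>\<sigma> | \<sigma> permutes {..<p}. ?t f \<sigma>)"
    by (rule sum.swap)
  also have "\<dots> = (\<Sum>f\<in>injections p n. \<Sum>\<sigma> | \<sigma> permutes {..<p}. ?t f \<sigma>)"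
  proof (rule sum.mono_neutral_right)
    show "\<forall>f\<in>?F - injections p n. (\<Sum>\<sigma> | \<sigma> permutes {..<p}. ?t f \<sigma>) = 0"
    proof
      fix f assume f: "f \<in> ?F - injections p n"
      then obtain i j where ij: "i < p" "j < p" "i \<noteq> j" "f i = f j" by (auto simp: inj_on_def)
      let ?B = "Matrix.mat p p (\<lambda>(i, k). G $$ (k, f i))"
      have "row ?B i = row ?B j" using ij by (intro eq_vecI) auto
      then have "Determinant.det ?B = 0"
        using ij by (intro det_identical_rows[of _ p i j]) auto
      moreover have "Determinant.det ?B = (\<Sum>\<sigma> | \<sigma> permutes {..<p}. signof \<sigma> * (\<Prod>i<p. G $$ (\<sigma> i, f i)))"
        using permutes_in_image[of _ "{..<p}"]
        by (subst det_def'[of _ p]) (auto simp: lessThan_atLeast0 intro!: sum.cong prod.cong arg_cong2[where f = "(*)"])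
      ultimately have "(\<Prod>i<p. G $$ (i, f i)) * (\<Sum>\<sigma> | \<sigma> permutes {..<p}. signof \<sigma> * (\<Prod>i<p. G $$ (\<sigma> i, f i))) = 0"
        by simp
      then show "(\<Sum>\<sigma> | \<sigma> permutes {..<p}. ?t f \<sigma>) = 0"
        by (simp add: sum_distrib_left mult.left_commute)
    qed
  qed (auto simp: finite_PiE)
  finally show ?thesis .
qed

text \<open>If both coordinates of \<open>h\<close> are injective, the first is a permutation
  \<open>\<pi>\<close> of the \<open>p\<close> rows, and the second factors uniquely as an injection
  \<open>f\<close> after \<open>\<pi>\<close>.\<close>

lemma bij_betw_perm_injections:
  "bij_betw (\<lambda>(\<pi>, f). restrict (\<lambda>k. (\<pi> k, f (\<pi> k))) {..<p})
     ({\<pi>. \<pi> permutes {..<p}} \<times> injections p n)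
     {h \<in> {..<p} \<rightarrow>\<^sub>E {..<p} \<times> {..<n}. inj_on (fst \<circ> h) {..<p} \<and> inj_on (snd \<circ> h) {..<p}}"
  (is "bij_betw ?\<Phi> ?A ?B")
proof (rule bij_betw_imageI)
  show "inj_on ?\<Phi> ?A"
  proof (rule inj_onI, clarify)
    fix \<pi> f \<rho> g
    assume \<pi>: "\<pi> permutes {..<p}" and \<rho>: "\<rho> permutes {..<p}"
      and f: "f \<in> {..<p} \<rightarrow>\<^sub>E {..<n}" and g: "g \<in> {..<p} \<rightarrow>\<^sub>E {..<n}"
      and eq: "restrict (\<lambda>k. (\<pi> k, f (\<pi> k))) {..<p} = restrict (\<lambda>k. (\<rho> k, g (\<rho> k))) {..<p}"
    have "(\<pi> k, f (\<pi> k)) = (\<rho> k, g (\<rho> k))" if "k < p" for k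
      using fun_cong[OF eq, of k] that by (simp del: prod.inject)
    then have *: "\<pi> k = \<rho> k" "f (\<pi> k) = g (\<rho> k)" if "k < p" for k
      using that by blast+
    have "\<pi> k = \<rho> k" for k
      using *(1)[of k] permutes_not_in[OF \<pi>, of k] permutes_not_in[OF \<rho>, of k] by (cases "k < p") auto
    then have "\<pi> = \<rho>" by blast
    moreover have "f = g"
    proof (rule PiE_ext[OF f g])
      fix i assume "i \<in> {..<p}"
      then obtain k where "k < p" "i = \<pi> k" using permutes_image[OF \<pi>] by (metis imageE lessThan_iff)
      then show "f i = g i" using * by metis
    qed
    ultimately show "\<pi> = \<rho> \<and> f = g" by simp
  qed
  show "?\<Phi> ` ?A = ?B"
  proof (intro equalityI subsetI)
    fix h assume "h \<in> ?\<Phi> ` ?A"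
    then obtain \<pi> f where \<pi>: "\<pi> permutes {..<p}" and f: "f \<in> {..<p} \<rightarrow>\<^sub>E {..<n}" "inj_on f {..<p}"
      and h: "h = restrict (\<lambda>k. (\<pi> k, f (\<pi> k))) {..<p}" by auto
    have \<pi>k: "\<pi> k < p" if "k < p" for k using permutes_in_image[OF \<pi>, of k] that by simp
    have "inj_on (f \<circ> \<pi>) {..<p}"
      using f(2) permutes_image[OF \<pi>] permutes_inj_on[OF \<pi>] by (intro comp_inj_on) simp_all
    moreover have "inj_on (fst \<circ> h) {..<p} \<longleftrightarrow> inj_on \<pi> {..<p}"
      "inj_on (snd \<circ> h) {..<p} \<longleftrightarrow> inj_on (f \<circ> \<pi>) {..<p}"
      by (rule inj_on_cong; simp add: h)+
    moreover have "inj_on \<pi> {..<p}" by (rule permutes_inj_on[OF \<pi>])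
    moreover have "h \<in> {..<p} \<rightarrow>\<^sub>E {..<p} \<times> {..<n}"
      unfolding h using \<pi>k PiE_mem[OF f(1)] by simp
    ultimately show "h \<in> ?B" by simp
  next
    fix h assume h: "h \<in> ?B"
    \<comment> \<open>Outside the rows \<open>\<pi>\<close> is the identity, as
      \<open>permutes\<close> demands. The requirement \<open>f (\<pi> k) = snd (h k)\<close> then
      forces the choice of \<open>f\<close>.\<close>
    define \<pi> where "\<pi> k = (if k < p then fst (h k) else k)" for k
    define f where "f = restrict (\<lambda>i. snd (h (inv_into UNIV \<pi> i))) {..<p}"
    have hk: "fst (h k) < p" "snd (h k) < n" if "k < p" for k
      using PiE_mem[of h "{..<p}" "\<lambda>_. {..<p} \<times> {..<n}" k] h that by (simp_all add: mem_Times_iff)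
    have "inj_on \<pi> {..<p} \<longleftrightarrow> inj_on (fst \<circ> h) {..<p}"
      by (rule inj_on_cong) (simp add: \<pi>_def)
    with h have inj: "inj_on \<pi> {..<p}" by simp
    have "\<pi> ` {..<p} = {..<p}"
      using hk by (intro endo_inj_surj inj) (auto simp: \<pi>_def)
    then have \<pi>: "\<pi> permutes {..<p}"
      using inj by (intro bij_imp_permutes) (auto simp: bij_betw_def \<pi>_def)
    have inv: "inv_into UNIV \<pi> (\<pi> k) = k" "inv_into UNIV \<pi> k < p \<longleftrightarrow> k < p" for k
      using permutes_inverses[OF \<pi>] permutes_in_image[OF permutes_inv[OF \<pi>], of k] by simp_all
    have "inj_on f {..<p}"
    proof (rule inj_onI)
      fix i j assume ij: "i \<in> {..<p}" "j \<in> {..<p}" "f i = f j"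
      have "inj_on (snd \<circ> h) {..<p}" using h by simp
      from inj_onD[OF this, of "inv_into UNIV \<pi> i" "inv_into UNIV \<pi> j"]
      have "inv_into UNIV \<pi> i = inv_into UNIV \<pi> j"
        using ij inv(2) by (simp add: f_def)
      then show "i = j" using permutes_inverses(1)[OF \<pi>] by metis
    qed
    moreover have "f \<in> {..<p} \<rightarrow>\<^sub>E {..<n}"
      using hk(2) inv(2) by (simp add: f_def)
    moreover have "h = ?\<Phi> (\<pi>, f)"
    proof
      fix k show "h k = ?\<Phi> (\<pi>, f) k"
      proof (cases "k < p")
        case True
        have "f (\<pi> k) = snd (h k)"
          using True inv(1)[of k] hk(1)[of k] by (simp add: f_def \<pi>_def)
        with True show ?thesis by (simp add: \<pi>_def)
      next
        case False
        have "h \<in> {..<p} \<rightarrow>\<^sub>E {..<p} \<times> {..<n}" using h by simp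
        from PiE_arb[OF this, of k] False show ?thesis by simp
      qed
    qed
    ultimately show "h \<in> ?\<Phi> ` ?A" using \<pi> by blast
  qed
qed

text \<open>Reindexing the product by the permutation shows that it depends on the injection alone,
  so every injection is counted \<open>fact p\<close> times. \<open>F\<close> is left arbitrary in
  order to be instantiated by the evaluation.\<close>

lemma sum_over_injective_pairs:
  fixes q :: "nat \<Rightarrow> nat \<Rightarrow> 'a::comm_monoid_mult" and F :: "'a \<Rightarrow> 'b::comm_semiring_1"
  shows "(\<Sum>h | h \<in> {..<p} \<rightarrow>\<^sub>E {..<p} \<times> {..<n} \<and> inj_on (fst \<circ> h) {..<p} \<and> inj_on (snd \<circ> h) {..<p}.
      F (\<Prod>k<p. q (fst (h k)) (snd (h k)))) =
    of_nat (fact p) * (\<Sum>f\<in>injections p n. F (\<Prod>i<p. q i (f i)))"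
proof -
  have "(\<Sum>h | h \<in> {..<p} \<rightarrow>\<^sub>E {..<p} \<times> {..<n} \<and> inj_on (fst \<circ> h) {..<p} \<and> inj_on (snd \<circ> h) {..<p}.
      F (\<Prod>k<p. q (fst (h k)) (snd (h k)))) =
    (\<Sum>(\<pi>, f)\<in>{\<pi>. \<pi> permutes {..<p}} \<times> injections p n. F (\<Prod>k<p. q (\<pi> k) (f (\<pi> k))))"
  proof (subst sum.reindex_bij_betw[OF bij_betw_perm_injections, symmetric], rule sum.cong[OF refl], clarify)
    fix \<pi> f :: "nat \<Rightarrow> nat"
    let ?h = "restrict (\<lambda>k. (\<pi> k, f (\<pi> k))) {..<p}"
    have "(\<Prod>k<p. q (fst (?h k)) (snd (?h k))) = (\<Prod>k<p. q (\<pi> k) (f (\<pi> k)))"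
      by (rule prod.cong) simp_all
    then show "F (\<Prod>k<p. q (fst (?h k)) (snd (?h k))) = F (\<Prod>k<p. q (\<pi> k) (f (\<pi> k)))" by simp
  qed
  also have "\<dots> = (\<Sum>(\<pi>, f)\<in>{\<pi>. \<pi> permutes {..<p}} \<times> injections p n. F (\<Prod>i<p. q i (f i)))"
  proof (rule sum.cong[OF refl], clarify)
    fix \<pi> f assume "\<pi> permutes {..<p}"
    then have "(\<Prod>k<p. q (\<pi> k) (f (\<pi> k))) = (\<Prod>i<p. q i (f i))"
      by (intro prod.reindex_bij_betw permutes_imp_bij)
    then show "F (\<Prod>k<p. q (\<pi> k) (f (\<pi> k))) = F (\<Prod>i<p. q i (f i))" by simp
  qed
  also have "\<dots> = of_nat (card {\<pi>. \<pi> permutes {..<p}}) * (\<Sum>f\<in>injections p n. F (\<Prod>i<p. q i (f i)))"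
    by (simp flip: sum.cartesian_product)
  finally show ?thesis by (simp add: card_permutations[OF card_lessThan])
qed

text \<open>Expanding the power gives a term for each map \<open>h\<close> from the \<open>p\<close>
  factors to index pairs. By \<open>E_delta_squares\<close> it survives exactly if its squared delta
  umbrae are all distinct, that is, if no row and no column is used twice.\<close>

lemma E_delta_quadratic_power:
  assumes eval: "umbral_evaluation E"
    and \<delta>: "\<And>i. i < p \<Longrightarrow> delta_umbra E (\<delta> i)" "\<And>j. j < n \<Longrightarrow> delta_umbra E (\<delta>' j)"
    and inj: "inj_on \<delta> {..<p}" "inj_on \<delta>' {..<n}" and disj: "\<delta> ` {..<p} \<inter> \<delta>' ` {..<n} = {}"
    and q: "\<And>i j. i < p \<Longrightarrow> j < n \<Longrightarrow> umbrae_of (q i j) \<inter> (\<delta> ` {..<p} \<union> \<delta>' ` {..<n}) = {}"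
  shows "E ((\<Sum>i<p. \<Sum>j<n. umbra (\<delta> i) ^ 2 * umbra (\<delta>' j) ^ 2 * q i j) ^ p) =
    fact p * (\<Sum>f\<in>injections p n. E (\<Prod>i<p. q i (f i)))"
proof -
  let ?I = "{..<p} \<times> {..<n}"
  let ?a = "\<lambda>(i, j). umbra (\<delta> i) ^ 2 * umbra (\<delta>' j) ^ 2 * q i j"
  let ?inj = "\<lambda>h. inj_on (fst \<circ> h) {..<p} \<and> inj_on (snd \<circ> h) {..<p}"
  have "(\<Sum>i<p. \<Sum>j<n. umbra (\<delta> i) ^ 2 * umbra (\<delta>' j) ^ 2 * q i j) ^ p = (\<Prod>k<p. \<Sum>x\<in>?I. ?a x)"
    by (simp add: sum.cartesian_product)
  also have "\<dots> = (\<Sum>h\<in>{..<p} \<rightarrow>\<^sub>E ?I. \<Prod>k<p. ?a (h k))"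
    by (intro prod_sum_PiE) auto
  finally have "E ((\<Sum>i<p. \<Sum>j<n. umbra (\<delta> i) ^ 2 * umbra (\<delta>' j) ^ 2 * q i j) ^ p) =
      (\<Sum>h\<in>{..<p} \<rightarrow>\<^sub>E ?I. E (\<Prod>k<p. ?a (h k)))"
    by (simp add: E_sum[OF eval])
  also have "\<dots> = (\<Sum>h\<in>{..<p} \<rightarrow>\<^sub>E ?I. if ?inj h then E (\<Prod>k<p. q (fst (h k)) (snd (h k))) else 0)"
  proof (rule sum.cong)
    fix h assume h: "h \<in> {..<p} \<rightarrow>\<^sub>E ?I"
    then have hk: "fst (h k) < p" "snd (h k) < n" if "k < p" for k
      using that by (auto simp: PiE_def Pi_def mem_Times_iff)
    \<comment> \<open>Lists the \<open>2 * p\<close> delta umbrae of the term, \<open>True\<close>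
      marking row umbrae and \<open>False\<close> column umbrae, so that one injectivity condition
      covers both families.\<close>
    define c where "c = (\<lambda>(k, b). if b then \<delta> (fst (h k)) else \<delta>' (snd (h k)))"
    let ?K = "{..<p} \<times> (UNIV :: bool set)"
    let ?q = "\<Prod>k<p. q (fst (h k)) (snd (h k))"
    have "(\<Prod>k<p. ?a (h k)) = (\<Prod>s\<in>?K. umbra (c s) ^ 2) * ?q"
    proof -
      have "(\<Prod>s\<in>?K. umbra (c s) ^ 2) = (\<Prod>k<p. \<Prod>b\<in>UNIV. umbra (c (k, b)) ^ 2)"
        by (simp add: prod.cartesian_product)
      then show ?thesis by (simp add: case_prod_unfold c_def UNIV_bool prod.distrib mult_ac)
    qed
    moreover have "umbrae_of ?q \<inter> c ` ?K = {}"
    proof -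
      have "umbrae_of (q (fst (h k)) (snd (h k))) \<inter> (\<delta> ` {..<p} \<union> \<delta>' ` {..<n}) = {}"
        if "k \<in> {..<p}" for k
        using q hk that by simp
      then have "umbrae_of ?q \<inter> (\<delta> ` {..<p} \<union> \<delta>' ` {..<n}) = {}"
        using umbrae_of_prod[of "\<lambda>k. q (fst (h k)) (snd (h k))" "{..<p}"] by blast
      moreover have "c ` ?K \<subseteq> \<delta> ` {..<p} \<union> \<delta>' ` {..<n}"
        using hk by (auto simp: c_def)
      ultimately show ?thesis by blast
    qed
    moreover have "delta_umbra E (c s)" if "s \<in> ?K" for s
      using that \<delta> hk by (auto simp: c_def)
    \<comment> \<open>Row and column umbrae never coincide, by \<open>disj\<close>; hence
      injectivity of \<open>c\<close> separates into the two coordinates.\<close>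
    moreover have "inj_on c ?K \<longleftrightarrow> ?inj h"
    proof -
      have c: "c (k, True) = \<delta> (fst (h k))" "c (k, False) = \<delta>' (snd (h k))" for k
        by (simp_all add: c_def)
      have d: "\<delta> (fst (h k)) \<noteq> \<delta>' (snd (h l))" if "k < p" "l < p" for k l
        using disj hk that by blast
      have e: "\<delta> (fst (h k)) = \<delta> (fst (h l)) \<longleftrightarrow> fst (h k) = fst (h l)"
        "\<delta>' (snd (h k)) = \<delta>' (snd (h l)) \<longleftrightarrow> snd (h k) = snd (h l)" if "k < p" "l < p" for k l
        using inj hk that by (auto dest: inj_onD)
      show ?thesis
      proof
        assume c_inj: "inj_on c ?K"
        have *: "k = l" if "k < p" "l < p" "c (k, b) = c (l, b)" for k l b
          using inj_onD[OF c_inj, of "(k, b)" "(l, b)"] that by simp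
        show "?inj h"
          using *[of _ _ True] *[of _ _ False] by (simp add: inj_on_def c)
      next
        assume "?inj h"
        then have *: "k = l" if "k < p" "l < p" "fst (h k) = fst (h l) \<or> snd (h k) = snd (h l)" for k l
          using that unfolding inj_on_def by auto
        show "inj_on c ?K"
        proof (rule inj_onI)
          fix s t assume st: "s \<in> ?K" "t \<in> ?K" "c s = c t"
          obtain k b l b' where s: "s = (k, b)" and t: "t = (l, b')" by (cases s, cases t)
          have kl: "k < p" "l < p" using st s t by auto
          have b: "b = b'"
            using st(3) d[OF kl] d[OF kl(2,1)] by (cases b; cases b') (auto simp: s t c)
          have "fst (h k) = fst (h l) \<or> snd (h k) = snd (h l)"
            using st(3) e[OF kl] b by (cases b') (auto simp: s t c)
          with *[OF kl] b show "s = t" by (simp add: s t)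
        qed
      qed
    qed
    ultimately show "E (\<Prod>k<p. ?a (h k)) = (if ?inj h then E ?q else 0)"
      using E_delta_squares[OF eval, of ?K c ?q] by simp
  qed simp
  also have "\<dots> = fact p * (\<Sum>f\<in>injections p n. E (\<Prod>i<p. q i (f i)))"
    using sum_over_injective_pairs[where F = E and q = q and p = p and n = n] by (simp add: sum.inter_filter finite_PiE)
  finally show ?thesis .
qed

subsection \<open>Whitened normal matrices\<close>

context
  fixes E :: "'u umbral_poly \<Rightarrow> real" and p n :: nat and M \<Sigma> A Q :: "real mat" and X :: "'u umbral_poly mat"
  assumes eval: "umbral_evaluation E" and X: "normal_umbral_matrix E p n M \<Sigma> X"
    and M: "M \<in> carrier_mat p n" and \<Sigma>: "\<Sigma> \<in> carrier_mat p p"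
    and A: "A \<in> carrier_mat p p" and Q: "Q \<in> carrier_mat n n"
    and mean: "\<forall>i<p. \<forall>j<n. i \<noteq> j \<longrightarrow> (A * M * Q) $$ (i, j) = 0"
    and whitening: "A * \<Sigma> * transpose_mat A = 1\<^sub>m p"
    and Q_orthogonal: "transpose_mat Q * Q = 1\<^sub>m n"
begin

text \<open>The coefficients that make an entry of \<open>A * X * Q\<close> a form in the entries of
  \<open>X\<close>, where \<open>A\<close> stands for P^T \<Sigma>^(-1/2).\<close>

definition entry_form :: "nat \<Rightarrow> nat \<Rightarrow> nat \<Rightarrow> nat \<Rightarrow> real" where
  "entry_form i j = (\<lambda>k l. A $$ (i, k) * Q $$ (l, j))"

lemma matrix_form_entry:
  assumes "Y \<in> carrier_mat p n" "i < p" "j < n"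
  shows "matrix_form p n (entry_form i j) Y = (A * Y * Q) $$ (i, j)"
  using index_mult_mult_mat[OF A assms(1) Q assms(2,3)] by (simp add: entry_form_def)

text \<open>The covariance factorizes into an entry of A \<Sigma> A^T and an entry of Q^T Q, both
  identity matrices.\<close>

lemma cov_form_entry:
  assumes "i < p" "i' < p" "j < n" "j' < n"
  shows "cov_form p n \<Sigma> (entry_form i j) (entry_form i' j') = (if i = i' \<and> j = j' then 1 else 0)"
proof -
  have "(A * \<Sigma> * transpose_mat A) $$ (i, i') =
      matrix_form p p (\<lambda>k l. A $$ (i, k) * transpose_mat A $$ (l, i')) \<Sigma>"
    using assms A \<Sigma> by (intro index_mult_mult_mat) auto
  also have "\<dots> = (\<Sum>k<p. \<Sum>l<p. A $$ (i, k) * \<Sigma> $$ (k, l) * A $$ (i', l))"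
    unfolding matrix_form_def using assms A by (subst sum.swap) (simp add: mult_ac)
  finally have a: "(\<Sum>k<p. \<Sum>l<p. A $$ (i, k) * \<Sigma> $$ (k, l) * A $$ (i', l)) = (if i = i' then 1 else 0)"
    using assms whitening by simp
  have "(transpose_mat Q * Q) $$ (j, j') = (\<Sum>l<n. Q $$ (l, j) * Q $$ (l, j'))"
    using assms Q by (simp add: scalar_prod_def lessThan_atLeast0)
  then have q: "(\<Sum>l<n. Q $$ (l, j) * Q $$ (l, j')) = (if j = j' then 1 else 0)"
    using assms Q_orthogonal by simp
  have "cov_form p n \<Sigma> (entry_form i j) (entry_form i' j') =
      (\<Sum>l<n. Q $$ (l, j) * Q $$ (l, j')) * (\<Sum>k<p. \<Sum>k'<p. A $$ (i, k) * \<Sigma> $$ (k, k') * A $$ (i', k'))"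
    unfolding cov_form_def entry_form_def sum_distrib_right
    unfolding sum_distrib_left by (simp add: mult_ac)
  then show ?thesis unfolding a q by simp
qed

text \<open>The \<open>2 * p\<close> factors of one term of \<open>det_mult_transpose\<close>. The
  flag keeps \<open>(i, f i)\<close> and \<open>(\<sigma> i, f i)\<close> apart as factors even when
  \<open>\<sigma> i = i\<close>.\<close>

definition pairing :: "(nat \<Rightarrow> nat) \<Rightarrow> (nat \<Rightarrow> nat) \<Rightarrow> nat \<times> bool \<Rightarrow> nat \<Rightarrow> nat \<Rightarrow> real" where
  "pairing \<sigma> f = (\<lambda>(i, b). entry_form (if b then i else \<sigma> i) (f i))"

text \<open>The common value of the expectation and of the umbral evaluation of the product of these
  factors.\<close>

definition pairing_moment :: "(nat \<Rightarrow> nat) \<Rightarrow> (nat \<Rightarrow> nat) \<Rightarrow> real" where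
  "pairing_moment \<sigma> f = gauss_prod_moment ({..<p} \<times> UNIV) (\<lambda>s. matrix_form p n (pairing \<sigma> f s) M)
     (\<lambda>s t. cov_form p n \<Sigma> (pairing \<sigma> f s) (pairing \<sigma> f t))"

lemma prod_pairing:
  "(\<Prod>s\<in>{..<p} \<times> UNIV. g (pairing \<sigma> f s)) =
     (\<Prod>i<p. g (entry_form i (f i))) * (\<Prod>i<p. g (entry_form (\<sigma> i) (f i)))"
  for g :: "_ \<Rightarrow> 'b::comm_monoid_mult"
proof -
  have "(\<Prod>s\<in>{..<p} \<times> UNIV. g (pairing \<sigma> f s)) = (\<Prod>i<p. \<Prod>b\<in>UNIV. g (pairing \<sigma> f (i, b)))"
    by (simp add: prod.cartesian_product)
  then show ?thesis by (simp add: pairing_def UNIV_bool prod.distrib mult.commute)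
qed

text \<open>If \<open>\<sigma> i \<noteq> i\<close>, the entries \<open>(i, f i)\<close> and \<open>(\<sigma> i, f i)\<close> each occur exactly once in the
  product, and at least one of them lies off the diagonal, hence is centred.\<close>

lemma pairing_moment_eq_0:
  assumes \<sigma>: "\<sigma> permutes {..<p}" "\<sigma> \<noteq> id" and f: "f \<in> injections p n"
  shows "pairing_moment \<sigma> f = 0"
proof -
  obtain i where i: "\<sigma> i \<noteq> i" using \<sigma>(2) by (auto simp: fun_eq_iff)
  then have ip: "i < p" using permutes_not_in[OF \<sigma>(1), of i] by auto
  have \<sigma>p: "\<sigma> k < p" if "k < p" for k using permutes_in_image[OF \<sigma>(1), of k] that by simp
  have fn: "f k < n" if "k < p" for k using f that by (auto simp: PiE_def Pi_def)
  have f_inj: "k = l" if "f k = f l" "k < p" "l < p" for k l using f that by (auto dest: inj_onD)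
  \<comment> \<open>The flag selects an entry off the diagonal: \<open>(i, f i)\<close> if possible,
    and otherwise \<open>f i = i\<close>, so that \<open>(\<sigma> i, f i)\<close> is off
    it.\<close>
  define b where "b \<longleftrightarrow> i \<noteq> f i"
  let ?r = "\<lambda>b k. if b then k else \<sigma> k"
  have off: "?r b i \<noteq> f i" using i by (auto simp: b_def)
  have cov: "cov_form p n \<Sigma> (pairing \<sigma> f (i, b)) (pairing \<sigma> f t) = 0"
    "cov_form p n \<Sigma> (pairing \<sigma> f t) (pairing \<sigma> f (i, b)) = 0"
    if t: "t \<in> {..<p} \<times> UNIV" "t \<noteq> (i, b)" for t
  proof -
    obtain k c where kc: "t = (k, c)" "k < p" using t by (cases t) auto
    \<comment> \<open>Equal columns force \<open>k = i\<close> by injectivity of \<open>f\<close>;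
      then the flags differ, and so do the rows \<open>i\<close> and
      \<open>\<sigma> i\<close>.\<close>
    have "\<not> (?r b i = ?r c k \<and> f i = f k)"
      using t kc f_inj[of i k] i ip by (cases b; cases c) auto
    then show "cov_form p n \<Sigma> (pairing \<sigma> f (i, b)) (pairing \<sigma> f t) = 0"
      "cov_form p n \<Sigma> (pairing \<sigma> f t) (pairing \<sigma> f (i, b)) = 0"
      unfolding pairing_def using kc ip \<sigma>p fn by (auto simp: cov_form_entry)
  qed
  have "matrix_form p n (pairing \<sigma> f (i, b)) M = (A * M * Q) $$ (?r b i, f i)"
    unfolding pairing_def using ip \<sigma>p fn by (simp only: prod.case) (intro matrix_form_entry M; simp)
  also have "\<dots> = 0" using ip \<sigma>p fn off mean by auto
  finally show ?thesis
    unfolding pairing_moment_def using ip cov by (intro gauss_prod_moment_eq_0[OF eval X M \<Sigma>, of _ "(i, b)"]) auto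
qed

text \<open>The expansion of \<open>det_mult_transpose\<close> is integrated term by term, and
  \<open>pairing_moment_eq_0\<close> removes every permutation except the identity.\<close>

lemma has_bochner_integral_det:
  assumes Y: "gaussian_matrix \<Omega> p n M \<Sigma> Y"
    and pos: "\<And>v. v \<in> carrier_vec p \<Longrightarrow> v \<noteq> 0\<^sub>v p \<Longrightarrow> 0 < v \<bullet> (\<Sigma> *\<^sub>v v)"
  shows "has_bochner_integral \<Omega> (\<lambda>\<omega>. Determinant.det ((A * Y \<omega> * Q) * transpose_mat (A * Y \<omega> * Q)))
           (\<Sum>f\<in>injections p n. pairing_moment id f)"
proof -
  let ?P = "{\<sigma>. \<sigma> permutes {..<p}}"
  have "(\<Sum>\<sigma>\<in>?P. signof \<sigma> * pairing_moment \<sigma> f) = pairing_moment id f" if "f \<in> injections p n" for f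
  proof -
    have "(\<Sum>\<sigma>\<in>?P. signof \<sigma> * pairing_moment \<sigma> f) = (\<Sum>\<sigma>\<in>{id}. signof \<sigma> * pairing_moment \<sigma> f)"
      using that pairing_moment_eq_0 by (intro sum.mono_neutral_right) (auto simp: finite_permutations permutes_id)
    then show ?thesis by simp
  qed
  moreover have "has_bochner_integral \<Omega> (\<lambda>\<omega>. \<Sum>f\<in>injections p n. \<Sum>\<sigma>\<in>?P.
      signof \<sigma> * (\<Prod>s\<in>{..<p} \<times> UNIV. matrix_form p n (pairing \<sigma> f s) (Y \<omega>)))
    (\<Sum>f\<in>injections p n. \<Sum>\<sigma>\<in>?P. signof \<sigma> * pairing_moment \<sigma> f)"
    unfolding pairing_moment_def
    by (intro has_bochner_integral_sum has_bochner_integral_mult_right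
        gaussian_matrix_form_prod[OF Y M \<Sigma> pos]) auto
  ultimately have "has_bochner_integral \<Omega> (\<lambda>\<omega>. \<Sum>f\<in>injections p n. \<Sum>\<sigma>\<in>?P.
      signof \<sigma> * (\<Prod>s\<in>{..<p} \<times> UNIV. matrix_form p n (pairing \<sigma> f s) (Y \<omega>)))
    (\<Sum>f\<in>injections p n. pairing_moment id f)" by simp
  moreover have "Determinant.det ((A * Y \<omega> * Q) * transpose_mat (A * Y \<omega> * Q)) =
      (\<Sum>f\<in>injections p n. \<Sum>\<sigma>\<in>?P.
        signof \<sigma> * (\<Prod>s\<in>{..<p} \<times> UNIV. matrix_form p n (pairing \<sigma> f s) (Y \<omega>)))"
    if "\<omega> \<in> space \<Omega>" for \<omega>
  proof -
    let ?G = "A * Y \<omega> * Q"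
    have Y\<omega>: "Y \<omega> \<in> carrier_mat p n" using Y that by (simp add: gaussian_matrix_def)
    then have G: "?G \<in> carrier_mat p n" using A Q by simp
    have "(\<Prod>s\<in>{..<p} \<times> UNIV. matrix_form p n (pairing \<sigma> f s) (Y \<omega>)) =
        (\<Prod>i<p. ?G $$ (i, f i)) * (\<Prod>i<p. ?G $$ (\<sigma> i, f i))"
      if "f \<in> injections p n" "\<sigma> permutes {..<p}" for f \<sigma>
    proof -
      have "f i < n" "\<sigma> i < p" if "i < p" for i
        using \<open>f \<in> injections p n\<close> permutes_in_image[OF \<open>\<sigma> permutes {..<p}\<close>, of i] that
        by (auto simp: PiE_def Pi_def)
      then show ?thesis
        unfolding prod_pairing[of "\<lambda>z. matrix_form p n z (Y \<omega>)"]
        by (intro arg_cong2[where f = "(*)"] prod.cong) (simp_all add: matrix_form_entry[OF Y\<omega>])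
    qed
    then show ?thesis unfolding det_mult_transpose[OF G] by (intro sum.cong) auto
  qed
  ultimately show ?thesis by (simp cong: has_bochner_integral_cong)
qed

text \<open>The diagonal factors scale rows and columns, so the trace is the sum of the squared
  entries, each weighted by the squares of its two delta umbrae. After
  \<open>E_delta_quadratic_power\<close>, the products of squares that remain are the pairings for
  \<open>id\<close>.\<close>

lemma E_delta_trace_power:
  assumes \<delta>: "\<And>i. i < p \<Longrightarrow> delta_umbra E (\<delta> i)" "\<And>j. j < n \<Longrightarrow> delta_umbra E (\<delta>' j)"
    and inj: "inj_on \<delta> {..<p}" "inj_on \<delta>' {..<n}" and disj: "\<delta> ` {..<p} \<inter> \<delta>' ` {..<n} = {}"
    and uncorrelated: "\<And>i j. i < p \<Longrightarrow> j < n \<Longrightarrow>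
      umbrae_of (X $$ (i, j)) \<inter> (\<delta> ` {..<p} \<union> \<delta>' ` {..<n}) = {}"
    and Y: "Y = mat_diag p (\<lambda>i. umbra (\<delta> i)) * (map_mat uconst A * X * map_mat uconst Q)
      * mat_diag n (\<lambda>j. umbra (\<delta>' j))"
  shows "E (mat_trace (Y * transpose_mat Y) ^ p) = fact p * (\<Sum>f\<in>injections p n. pairing_moment id f)"
proof -
  let ?G = "map_mat uconst A * X * map_mat uconst Q"
  let ?D = "\<delta> ` {..<p} \<union> \<delta>' ` {..<n}"
  have X': "X \<in> carrier_mat p n" using X by (simp add: normal_umbral_matrix_def)
  then have G: "?G \<in> carrier_mat p n" using A Q by simp
  define g where "g z = matrix_form p n (\<lambda>k l. uconst (z k l)) X" for z
  have Gij: "?G $$ (i, j) = g (entry_form i j)" if "i < p" "j < n" for i j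
  proof -
    have "?G $$ (i, j) = matrix_form p n (\<lambda>k l. map_mat uconst A $$ (i, k) * map_mat uconst Q $$ (l, j)) X"
      using A Q X' that by (intro index_mult_mult_mat) auto
    then show ?thesis
      using A Q that by (simp add: g_def matrix_form_def entry_form_def uconst_mult)
  qed
  have Y_carrier: "Y \<in> carrier_mat p n"
    unfolding Y by (intro mult_carrier_mat[of _ p n _ n] mult_carrier_mat[of _ p p _ n] G mat_diag_dim)
  have "mat_trace (Y * transpose_mat Y) = (\<Sum>i<p. \<Sum>j<n. Y $$ (i, j) * Y $$ (i, j))"
    using mat_trace_transpose_mult[of "transpose_mat Y" n p "transpose_mat Y"] Y_carrier by simp
  also have "\<dots> = (\<Sum>i<p. \<Sum>j<n. umbra (\<delta> i) ^ 2 * umbra (\<delta>' j) ^ 2 * g (entry_form i j) ^ 2)"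
    unfolding Y using G Gij
    by (intro sum.cong refl) (simp add: mat_diag_mult_left[OF G] mat_diag_mult_right[of _ p n] power2_eq_square mult_ac)
  finally have "E (mat_trace (Y * transpose_mat Y) ^ p) =
      fact p * (\<Sum>f\<in>injections p n. E (\<Prod>i<p. g (entry_form i (f i)) ^ 2))"
  proof (simp only:, intro E_delta_quadratic_power eval \<delta> inj disj)
    fix i j :: nat
    \<comment> \<open>A real combination of entries of \<open>X\<close> contains no delta
      umbra.\<close>
    have "umbrae_of (g z) \<inter> ?D = {}" for z
    proof -
      have "umbrae_of (uconst (z k l) * X $$ (k, l)) \<inter> ?D = {}" if "k < p" "l < n" for k l
        using umbrae_of_mult[of "uconst (z k l)" "X $$ (k, l)"] uncorrelated[OF that]
        by (auto simp: umbrae_of_uconst)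
      then have "umbrae_of (\<Sum>k<p. uconst (z k l) * X $$ (k, l)) \<inter> ?D = {}" if "l < n" for l
        using umbrae_of_sum[of "\<lambda>k. uconst (z k l) * X $$ (k, l)" "{..<p}"] that by blast
      then show ?thesis
        using umbrae_of_sum[of "\<lambda>l. \<Sum>k<p. uconst (z k l) * X $$ (k, l)" "{..<n}"]
        unfolding g_def matrix_form_def by blast
    qed
    then show "umbrae_of (g (entry_form i j) ^ 2) \<inter> ?D = {}"
      using umbrae_of_mult[of "g (entry_form i j)" "g (entry_form i j)"]
      unfolding power2_eq_square by blast
  qed
  also have "(\<Sum>f\<in>injections p n. E (\<Prod>i<p. g (entry_form i (f i)) ^ 2)) =
      (\<Sum>f\<in>injections p n. pairing_moment id f)"
  proof (rule sum.cong[OF refl])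
    fix f
    have "(\<Prod>i<p. g (entry_form i (f i)) ^ 2) = (\<Prod>s\<in>{..<p} \<times> UNIV. g (pairing id f s))"
      by (simp add: prod_pairing power2_eq_square prod.distrib)
    then show "E (\<Prod>i<p. g (entry_form i (f i)) ^ 2) = pairing_moment id f"
      unfolding pairing_moment_def g_def
      using E_normal_form_prod[OF eval X M \<Sigma>, of "{..<p} \<times> UNIV" "pairing id f"] by simp
  qed
  finally show ?thesis .
qed

end

text \<open>By symmetry the value is the squared length of \<open>H *\<^sub>v v\<close>, and the
  left inverse \<open>K\<close> keeps this vector nonzero. For \<open>H\<close> the square root of
  \<Sigma> this yields the strictly positive variances that the densities require.\<close>

lemma scalar_prod_gram_pos:
  fixes H :: "real mat"
  assumes H: "H \<in> carrier_mat p p" "transpose_mat H = H" and K: "K \<in> carrier_mat p p" "K * H = 1\<^sub>m p"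
    and v: "v \<in> carrier_vec p" "v \<noteq> 0\<^sub>v p"
  shows "0 < v \<bullet> ((H * H) *\<^sub>v v)"
proof -
  let ?w = "H *\<^sub>v v"
  have w: "?w \<in> carrier_vec p" using H v by simp
  have "K *\<^sub>v ?w = v" using H K v by (simp flip: assoc_mult_mat_vec)
  moreover have "K *\<^sub>v 0\<^sub>v p = 0\<^sub>v p" using K by (intro eq_vecI) simp_all
  ultimately have "?w \<noteq> 0\<^sub>v p" using v by auto
  moreover have "0 < x \<bullet> x" if x: "x \<in> carrier_vec p" "x \<noteq> 0\<^sub>v p" for x :: "real Matrix.vec"
  proof -
    have "x = 0\<^sub>v p" if "\<And>i. i < p \<Longrightarrow> x $ i = 0"
      using x that by (intro eq_vecI) auto
    then obtain i where "i < p" "x $ i \<noteq> 0" using x by blast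
    then have "0 < (\<Sum>i<p. x $ i * x $ i)"
      by (intro sum_pos2[of _ i]) (auto simp: zero_less_mult_iff)
    then show ?thesis using x by (simp add: scalar_prod_def lessThan_atLeast0)
  qed
  ultimately have "0 < ?w \<bullet> ?w" using w by blast
  also have "\<dots> = v \<bullet> (H *\<^sub>v ?w)"
    using transpose_vec_mult_scalar[OF H(1) v(1) w] H w v by (simp add: comm_scalar_prod[OF v(1)])
  also have "H *\<^sub>v ?w = (H * H) *\<^sub>v v" using H v by simp
  finally show ?thesis .
qed

section \<open>Whitening by the inverse square root and comparison of both sides\<close>

theorem corollary5p5:
  fixes p n :: nat
    and M \<Sigma> \<Sigma>half \<Sigma>invhalf P Q :: "real mat"
    and m :: "nat \<Rightarrow> real"
    and E :: "'u umbral_poly \<Rightarrow> real"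
    and X :: "'u umbral_poly mat"
    and \<delta> \<delta>' :: "nat \<Rightarrow> 'u"
    and \<Omega> :: "'w measure"
    and W :: "'w \<Rightarrow> real mat"
  assumes "1 \<le> p" and "p \<le> n"
    and "M \<in> carrier_mat p n"
    and "covariance_matrix p \<Sigma>" and "vec_space.rank p \<Sigma> = p"
    and "\<Sigma>half \<in> carrier_mat p p" and "transpose_mat \<Sigma>half = \<Sigma>half" and "\<Sigma>half * \<Sigma>half = \<Sigma>"
    and "\<Sigma>invhalf \<in> carrier_mat p p" and "inverts_mat \<Sigma>half \<Sigma>invhalf" and "inverts_mat \<Sigma>invhalf \<Sigma>half"
    and "umbral_evaluation E"
    and "normal_umbral_matrix E p n M \<Sigma> X"
    and "orthogonal_matrix_of_order p P" and "orthogonal_matrix_of_order n Q"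
    and "\<Sigma>invhalf * M = P * rect_diag p n m * transpose_mat Q"
    and "wishart_matrix \<Omega> p n \<Sigma> M W"
    and "\<And>i. i < p \<Longrightarrow> delta_umbra E (\<delta> i)" and "\<And>j. j < n \<Longrightarrow> delta_umbra E (\<delta>' j)"
    and "inj_on \<delta> {..<p}" and "inj_on \<delta>' {..<n}" and "\<delta> ` {..<p} \<inter> \<delta>' ` {..<n} = {}"
    and "\<And>i j. i < p \<Longrightarrow> j < n \<Longrightarrow>
           umbrae_of (X $$ (i, j)) \<inter> (\<delta> ` {..<p} \<union> \<delta>' ` {..<n}) = {}"
  shows "fact p * (\<integral>\<omega>. Tr p (W \<omega>) \<partial>\<Omega>) =
    (let Y = mat_diag p (\<lambda>i. umbra (\<delta> i)) * map_mat uconst (transpose_mat P)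
             * (map_mat uconst \<Sigma>invhalf * X)
             * map_mat uconst Q * mat_diag n (\<lambda>j. umbra (\<delta>' j))
     in Determinant.det \<Sigma> * E (mat_trace (Y * transpose_mat Y) ^ p))"
proof -
  note M = \<open>M \<in> carrier_mat p n\<close> and H = \<open>\<Sigma>half \<in> carrier_mat p p\<close> \<open>transpose_mat \<Sigma>half = \<Sigma>half\<close>
    and K = \<open>\<Sigma>invhalf \<in> carrier_mat p p\<close>
  have \<Sigma>: "\<Sigma> \<in> carrier_mat p p" using assms(4) by (simp add: covariance_matrix_def)
  have KH: "\<Sigma>invhalf * \<Sigma>half = 1\<^sub>m p" using assms(11) K by (simp add: inverts_mat_def)
  have P: "P \<in> carrier_mat p p" "transpose_mat P * P = 1\<^sub>m p"
    and Q_orth: "Q \<in> carrier_mat n n" "transpose_mat Q * Q = 1\<^sub>m n" "Q * transpose_mat Q = 1\<^sub>m n"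
    using assms(14,15) by (simp_all add: orthogonal_matrix_of_order_def)
  have X_carrier: "X \<in> carrier_mat p n" using assms(13) by (simp add: normal_umbral_matrix_def)
  \<comment> \<open>Whitening followed by the rotation P^T; the covariance becomes the identity and
    \<open>A * M * Q\<close> becomes rectangular diagonal.\<close>
  define A where "A = transpose_mat P * \<Sigma>invhalf"
  have A: "A \<in> carrier_mat p p" using P K by (simp add: A_def)
  have AH: "A * \<Sigma>half = transpose_mat P"
    using P K H KH by (simp add: A_def)
  have whitening: "A * \<Sigma> * transpose_mat A = 1\<^sub>m p"
  proof -
    \<comment> \<open>Symmetry of \<open>\<Sigma>half\<close> lets A \<Sigma> A^T be read as the
      product of \<open>A * \<Sigma>half\<close> with its transpose, which is P^T P.\<close>
    have "transpose_mat (A * \<Sigma>half) = \<Sigma>half * transpose_mat A"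
      using A H by (simp add: transpose_mult)
    then have "A * \<Sigma> * transpose_mat A = (A * \<Sigma>half) * transpose_mat (A * \<Sigma>half)"
      using A H by (simp add: assoc_mult_mat[of _ p p _ p _ p] flip: \<open>\<Sigma>half * \<Sigma>half = \<Sigma>\<close>)
    then show ?thesis using P by (simp add: AH)
  qed
  have diag: "A * M * Q = rect_diag p n m"
  proof -
    have D: "rect_diag p n m \<in> carrier_mat p n" by (simp add: rect_diag_def)
    have "A * M * Q = transpose_mat P * (\<Sigma>invhalf * M) * Q"
      using P K M by (simp add: A_def)
    also have "\<dots> = (transpose_mat P * P) * rect_diag p n m * (transpose_mat Q * Q)"
      unfolding assms(16) using P(1) Q_orth(1) D
      by (simp add: assoc_mult_mat[of _ p p _ p _ n] assoc_mult_mat[of _ p p _ n _ n] assoc_mult_mat[of _ p n _ n _ n])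
    finally show ?thesis using P Q_orth D by simp
  qed
  have mean: "\<forall>i<p. \<forall>j<n. i \<noteq> j \<longrightarrow> (A * M * Q) $$ (i, j) = 0"
    by (simp add: diag rect_diag_def)
  note whitened = assms(12,13) M \<Sigma> A Q_orth(1) mean whitening Q_orth(2)
  let ?S = "\<Sum>f\<in>injections p n. pairing_moment p n M \<Sigma> A Q id f"
  obtain Z where Z: "gaussian_matrix \<Omega> p n M \<Sigma> Z"
    and W: "\<And>\<omega>. \<omega> \<in> space \<Omega> \<Longrightarrow> W \<omega> = Z \<omega> * transpose_mat (Z \<omega>)"
    using assms(17) by (auto simp: wishart_matrix_def)
  \<comment> \<open>Since Q Q^T is the identity, det(G G^T) = det(A)^2 det(W) for G = A Z Q. This
    relation converts det(\<Sigma>) det(G G^T) back into det(W).\<close>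
  have det_A: "Determinant.det A * Determinant.det \<Sigma> * Determinant.det A = 1"
    using arg_cong[OF whitening, of Determinant.det] A \<Sigma> by (simp add: det_mult[of _ p] det_transpose[of _ p])
  have "Tr p (W \<omega>) = Determinant.det \<Sigma> * Determinant.det ((A * Z \<omega> * Q) * transpose_mat (A * Z \<omega> * Q))"
    if "\<omega> \<in> space \<Omega>" for \<omega>
  proof -
    let ?Z = "Z \<omega>" and ?G = "A * Z \<omega> * Q"
    have Z\<omega>: "?Z \<in> carrier_mat p n" using Z that by (simp add: gaussian_matrix_def)
    have "?G * transpose_mat ?G = A * ?Z * (Q * transpose_mat Q) * (transpose_mat ?Z * transpose_mat A)"
      using A Q_orth(1) Z\<omega> by (simp add: transpose_mult[of _ p n _ n] transpose_mult[of _ p p _ n]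
          assoc_mult_mat[of _ p n _ n _ p] assoc_mult_mat[of _ p n _ n _ n] assoc_mult_mat[of _ n n _ n _ p]
          assoc_mult_mat[of _ p p _ n _ p])
    also have "\<dots> = A * (?Z * transpose_mat ?Z) * transpose_mat A"
      using A Z\<omega> Q_orth by (simp add: assoc_mult_mat[of _ p p _ n _ p] assoc_mult_mat[of _ p p _ p _ p] assoc_mult_mat[of _ p n _ p _ p])
    finally have "Determinant.det (?G * transpose_mat ?G) =
        Determinant.det A * Determinant.det (W \<omega>) * Determinant.det A"
      using A Z\<omega> W[OF that] by (simp add: det_mult[of _ p] det_transpose[of _ p])
    then have "Determinant.det \<Sigma> * Determinant.det (?G * transpose_mat ?G) =
        (Determinant.det A * Determinant.det \<Sigma> * Determinant.det A) * Determinant.det (W \<omega>)"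
      by simp
    moreover have "Tr p (W \<omega>) = Determinant.det (W \<omega>)"
      using W[OF that] Z\<omega> by (intro Tr_eq_det) simp
    ultimately show ?thesis by (simp add: det_A)
  qed
  then have "(\<integral>\<omega>. Tr p (W \<omega>) \<partial>\<Omega>) =
      (\<integral>\<omega>. Determinant.det \<Sigma> * Determinant.det ((A * Z \<omega> * Q) * transpose_mat (A * Z \<omega> * Q)) \<partial>\<Omega>)"
    by (intro Bochner_Integration.integral_cong) auto
  also have "\<dots> = Determinant.det \<Sigma> * ?S"
  proof (intro has_bochner_integral_integral_eq has_bochner_integral_mult_right
      has_bochner_integral_det[OF whitened] Z)
    show "0 < v \<bullet> (\<Sigma> *\<^sub>v v)" if "v \<in> carrier_vec p" "v \<noteq> 0\<^sub>v p" for v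
      using scalar_prod_gram_pos[OF H K KH that] \<open>\<Sigma>half * \<Sigma>half = \<Sigma>\<close> by simp
  qed
  finally have lhs: "(\<integral>\<omega>. Tr p (W \<omega>) \<partial>\<Omega>) = Determinant.det \<Sigma> * ?S" .
  have map_A: "map_mat uconst A = map_mat uconst (transpose_mat P) * map_mat uconst \<Sigma>invhalf"
    using P K by (intro eq_matI) (auto simp: A_def scalar_prod_def uconst_sum uconst_mult)
  define Y where "Y = mat_diag p (\<lambda>i. umbra (\<delta> i)) * map_mat uconst (transpose_mat P)
    * (map_mat uconst \<Sigma>invhalf * X) * map_mat uconst Q * mat_diag n (\<lambda>j. umbra (\<delta>' j))"
  have "Y = mat_diag p (\<lambda>i. umbra (\<delta> i)) * (map_mat uconst A * X * map_mat uconst Q)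
      * mat_diag n (\<lambda>j. umbra (\<delta>' j))"
  proof -
    let ?D = "mat_diag p (\<lambda>i. umbra (\<delta> i))" and ?P = "map_mat uconst (transpose_mat P)"
      and ?K = "map_mat uconst \<Sigma>invhalf" and ?Q = "map_mat uconst Q"
    have c: "?P \<in> carrier_mat p p" "?K \<in> carrier_mat p p" "?Q \<in> carrier_mat n n"
      using P K Q_orth by simp_all
    have "?D * ?P * (?K * X) * ?Q = ?D * (?P * ?K * X * ?Q)"
      using c X_carrier by (simp add: assoc_mult_mat[of _ p p _ p _ n] assoc_mult_mat[of _ p p _ n _ n] assoc_mult_mat[of _ p p _ p _ p])
    then show ?thesis by (simp add: Y_def map_A)
  qed
  then have "E (mat_trace (Y * transpose_mat Y) ^ p) = fact p * ?S"
    by (rule E_delta_trace_power[OF whitened, rotated -1]) (fact assms(18-23))+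
  then show ?thesis unfolding lhs Y_def[symmetric] by (simp add: Let_def)
qed

end
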